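(* Let $S$ be a cancellative and right amenable monoid, $K$ a compact (Hausdorff) group, $\rho$ a right $S$-action on $K$ by continuous endomorphisms, and $H$ a closed $S$-invariant subgroup of $K$ (not necessarily normal). Let $\rho_H$ be the restriction of $\rho$ to $H$ and let $\rho_{K/H}$ be the right $S$-action induced by $\rho$ on the compact space $K/H$ of left $H$-cosets. Then $$h_{\mathrm{top}}(\rho)=h_{\mathrm{top}}(\rho_H)+h_{\mathrm{top}}(\rho_{K/H}).$$
   Context: Compact means compact Hausdorff. A cancellative monoid $S$ is right amenable if it admits a right F{\o}lner net, i.e. a net $\{F_i\}_{i\in I}$ of non-empty finite subsets of $S$ such that $\lim_{i\in I}|F_is\setminus F_i|/|F_i|=0$ for every $s\in S$. A right $S$-action $\rho$ on a compact space $K$ is a family of continuous self-maps $\rho_s\colon K\to K$ ($s\in S$) with $\rho_1=\mathrm{id}_K$ and $\rho_{st}=\rho_t\circ\rho_s$ for all $s,t\in S$; if $K$ is a compact group each $\rho_s$ is required to be a continuous group endomorphism. A subgroup $H$ of $K$ is $S$-invariant if $\rho_s(H)\subseteq H$ for all $s\in S$; then $(\rho_H)_s=\rho_s|_H$ and $(\rho_{K/H})_s(kH)=\rho_s(k)H$, where $K/H=\{kH:k\in K\}$ carries the quotient topology. Topological entropy: for an open cover $\mathcal U$ of $K$ let $N(\mathcal U)$ be the minimal cardinality of a subcover; $\mathcal U\vee\mathcal V=\{U\cap V:U\in\mathcal U,V\in\mathcal V\}$; for a non-empty finite $F\subseteq S$ let $\mathcal U_{\rho,F}=\bigvee_{s\in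 F}\rho_s^{-1}(\mathcal U)$. For a right F{\o}lner net $\{F_i\}_{i\in I}$ of $S$ put $H_{\mathrm{top}}(\rho,\mathcal U)=\lim_{i\in I}\frac{\log N(\mathcal U_{\rho,F_i})}{|F_i|}$ (the limit exists and does not depend on the net), and $h_{\mathrm{top}}(\rho)=\sup_{\mathcal U}H_{\mathrm{top}}(\rho,\mathcal U)\in[0,\infty]$, the supremum being over all open covers of $K$. *)

theory Defs
  imports "HOL-Analysis.Analysis" "HOL-Algebra.Divisibility" "HOL-Algebra.Left_Coset"
begin

definition directed_preorder :: "'i set \<Rightarrow> 'i rel \<Rightarrow> bool" where
  "directed_preorder I r \<longleftrightarrow> I \<noteq> {} \<and> preorder_on I r \<and>
     (\<forall>i\<in>I. \<forall>j\<in>I. \<exists>k\<in>I. (i, k) \<in> r \<and> (j, k) \<in> r)"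

text \<open>The filter of tails; convergence of a net indexed by \<open>I\<close> is convergence along it.\<close>

definition net_filter :: "'i set \<Rightarrow> 'i rel \<Rightarrow> 'i filter" where
  "net_filter I r = (INF i\<in>I. principal {j \<in> I. (i, j) \<in> r})"

lemma eventually_net_filter:
  assumes "directed_preorder I r"
  shows "eventually P (net_filter I r) \<longleftrightarrow> (\<exists>i\<in>I. \<forall>j\<in>I. (i, j) \<in> r \<longrightarrow> P j)"
proof -
  have "\<exists>k\<in>I. principal {j \<in> I. (k, j) \<in> r} \<le>
          inf (principal {j \<in> I. (a, j) \<in> r}) (principal {j \<in> I. (b, j) \<in> r})"
    if ab: "a \<in> I" "b \<in> I" for a b
  proof -
    from assms ab obtain k where "k \<in> I" "(a, k) \<in> r" "(b, k) \<in> r"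
      unfolding directed_preorder_def by blast
    moreover have "trans r"
      using assms unfolding directed_preorder_def preorder_on_def by blast
    ultimately show ?thesis
      by (intro bexI[of _ k]) (auto dest: transD)
  qed
  moreover have "I \<noteq> {}"
    using assms unfolding directed_preorder_def by blast
  ultimately have "eventually P (net_filter I r) \<longleftrightarrow>
      (\<exists>i\<in>I. eventually P (principal {j \<in> I. (i, j) \<in> r}))"
    unfolding net_filter_def by (intro eventually_INF_base) auto
  then show ?thesis
    by (auto simp: eventually_principal)
qed

definition right_folner_net ::
    "('s, 'm) monoid_scheme \<Rightarrow> 'i set \<Rightarrow> 'i rel \<Rightarrow> ('i \<Rightarrow> 's set) \<Rightarrow> bool" where
  "right_folner_net S I r F \<longleftrightarrow> directed_preorder I r \<and>
     (\<forall>i\<in>I. F i \<noteq> {} \<and> finite (F i) \<and> F i \<subseteq> carrier S) \<and>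
     (\<forall>s\<in>carrier S.
        ((\<lambda>i. real (card ((F i #>\<^bsub>S\<^esub> s) - F i)) / real (card (F i))) \<longlongrightarrow> 0) (net_filter I r))"

text \<open>HOL cannot quantify existentially over the type of indices. The type chosen here is
  large enough: \<open>right_folner_net_imp_right_amenable\<close> shows that a right Folner net indexed by
  any type whatsoever yields one indexed by this type.\<close>

definition right_amenable :: "('s, 'm) monoid_scheme \<Rightarrow> bool" where
  "right_amenable S \<longleftrightarrow>
     (\<exists>(I :: ('s set \<times> nat) set) r F. right_folner_net S I r F)"

lemma right_folner_net_imp_right_amenable:
  assumes "right_folner_net S I r F"
  shows "right_amenable S"
proof -
  define q where "q = (\<lambda>A s. real (card ((A #>\<^bsub>S\<^esub> s) - A)) / real (card A))"
  define J where "J = {E. finite E \<and> E \<subseteq> carrier S} \<times> (UNIV :: nat set)"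
  define r' where "r' = {((D, m), (E, n)). (D, m) \<in> J \<and> (E, n) \<in> J \<and> D \<subseteq> E \<and> m \<le> n}"
  have dir: "directed_preorder I r"
    and F: "\<And>i. i \<in> I \<Longrightarrow> F i \<noteq> {} \<and> finite (F i) \<and> F i \<subseteq> carrier S"
    and lim: "\<And>s. s \<in> carrier S \<Longrightarrow> ((\<lambda>i. q (F i) s) \<longlongrightarrow> 0) (net_filter I r)"
    using assms unfolding right_folner_net_def q_def by auto
  have ex: "\<exists>i\<in>I. \<forall>s\<in>E. q (F i) s < 1 / real (Suc n)"
    if "finite E" "E \<subseteq> carrier S" for E n
  proof -
    have "eventually (\<lambda>i. q (F i) s < 1 / real (Suc n)) (net_filter I r)" if "s \<in> E" for s
      by (rule order_tendstoD(2)[OF lim]) (use that \<open>E \<subseteq> carrier S\<close> in auto)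
    then have "eventually (\<lambda>i. \<forall>s\<in>E. q (F i) s < 1 / real (Suc n)) (net_filter I r)"
      using \<open>finite E\<close> by (simp add: eventually_ball_finite)
    then obtain i where i: "i \<in> I" "\<forall>j\<in>I. (i, j) \<in> r \<longrightarrow> (\<forall>s\<in>E. q (F j) s < 1 / real (Suc n))"
      unfolding eventually_net_filter[OF dir] by blast
    moreover have "(i, i) \<in> r"
      using dir i(1) unfolding directed_preorder_def preorder_on_def refl_on_def by blast
    ultimately show ?thesis by blast
  qed
  have "\<forall>p\<in>J. \<exists>i. i \<in> I \<and> (\<forall>s\<in>fst p. q (F i) s < 1 / real (Suc (snd p)))"
    using ex unfolding J_def by fastforce
  then obtain g where g: "\<And>p. p \<in> J \<Longrightarrow> g p \<in> I \<and> (\<forall>s\<in>fst p. q (F (g p)) s < 1 / real (Suc (snd p)))"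
    by metis
  have dir': "directed_preorder J r'"
    unfolding directed_preorder_def
  proof (intro conjI ballI)
    show "J \<noteq> {}" unfolding J_def by auto
    show "preorder_on J r'"
      unfolding preorder_on_def refl_on_def trans_def r'_def by auto
    fix a b assume "a \<in> J" "b \<in> J"
    then show "\<exists>k\<in>J. (a, k) \<in> r' \<and> (b, k) \<in> r'"
      by (intro bexI[of _ "(fst a \<union> fst b, max (snd a) (snd b))"])
         (auto simp: J_def r'_def)
  qed
  have "((\<lambda>p. q (F (g p)) s) \<longlongrightarrow> 0) (net_filter J r')" if s: "s \<in> carrier S" for s
  proof (rule order_tendstoI)
    fix a :: real assume "a < 0"
    moreover have "0 \<le> q A s" for A unfolding q_def by simp
    ultimately have "a < q A s" for A by (meson less_le_trans)
    then show "eventually (\<lambda>p. a < q (F (g p)) s) (net_filter J r')" by simp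
  next
    fix a :: real assume "0 < a"
    then obtain n where n: "1 / real (Suc n) < a"
      using nat_approx_posE by blast
    have "q (F (g p)) s < a" if p: "p \<in> J" "(({s}, n), p) \<in> r'" for p
    proof -
      have "s \<in> fst p" "n \<le> snd p" using p unfolding r'_def by auto
      then have "q (F (g p)) s < 1 / real (Suc (snd p))" using g p by blast
      also have "\<dots> \<le> 1 / real (Suc n)" using \<open>n \<le> snd p\<close> by (simp add: field_simps)
      finally show ?thesis using n by simp
    qed
    moreover have "({s}, n) \<in> J" using s unfolding J_def by auto
    ultimately show "eventually (\<lambda>p. q (F (g p)) s < a) (net_filter J r')"
      unfolding eventually_net_filter[OF dir'] by blast
  qed
  then have "right_folner_net S J r' (F \<circ> g)"
    unfolding right_folner_net_def using dir' F g by (auto simp: q_def)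
  then show ?thesis unfolding right_amenable_def by blast
qed

locale compact_group = group G for G :: "('k, 'm) monoid_scheme" (structure) +
  fixes T :: "'k topology"
  assumes topspace_eq: "topspace T = carrier G"
    and continuous_mult: "continuous_map (prod_topology T T) T (\<lambda>(x, y). x \<otimes> y)"
    and continuous_inv: "continuous_map T T (\<lambda>x. inv x)"
    and compact: "compact_space T"
    and Hausdorff: "Hausdorff_space T"

definition right_action ::
    "('s, 'm) monoid_scheme \<Rightarrow> 'k topology \<Rightarrow> ('s \<Rightarrow> 'k \<Rightarrow> 'k) \<Rightarrow> bool" where
  "right_action S X \<rho> \<longleftrightarrow>
     (\<forall>s\<in>carrier S. continuous_map X X (\<rho> s)) \<and>
     (\<forall>x\<in>topspace X. \<rho> \<one>\<^bsub>S\<^esub> x = x) \<and>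
     (\<forall>s\<in>carrier S. \<forall>t\<in>carrier S. \<forall>x\<in>topspace X. \<rho> (s \<otimes>\<^bsub>S\<^esub> t) x = \<rho> t (\<rho> s x))"

definition right_group_action ::
    "('s, 'm) monoid_scheme \<Rightarrow> ('k, 'n) monoid_scheme \<Rightarrow> 'k topology \<Rightarrow> ('s \<Rightarrow> 'k \<Rightarrow> 'k) \<Rightarrow> bool" where
  "right_group_action S G T \<rho> \<longleftrightarrow> right_action S T \<rho> \<and> (\<forall>s\<in>carrier S. \<rho> s \<in> hom G G)"

definition invariant_under ::
    "('s, 'm) monoid_scheme \<Rightarrow> ('s \<Rightarrow> 'k \<Rightarrow> 'k) \<Rightarrow> 'k set \<Rightarrow> bool" where
  "invariant_under S \<rho> H \<longleftrightarrow> (\<forall>s\<in>carrier S. \<rho> s ` H \<subseteq> H)"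

definition restricted_action :: "('s \<Rightarrow> 'k \<Rightarrow> 'k) \<Rightarrow> 'k set \<Rightarrow> 's \<Rightarrow> 'k \<Rightarrow> 'k" where
  "restricted_action \<rho> H s = restrict (\<rho> s) H"

definition quotient_topology :: "'a topology \<Rightarrow> ('a \<Rightarrow> 'b) \<Rightarrow> 'b topology" where
  "quotient_topology X p =
     topology (\<lambda>U. U \<subseteq> p ` topspace X \<and> openin X {x \<in> topspace X. p x \<in> U})"

lemma openin_quotient_topology:
  "openin (quotient_topology X p) U \<longleftrightarrow>
     U \<subseteq> p ` topspace X \<and> openin X {x \<in> topspace X. p x \<in> U}"
proof -
  have "istopology (\<lambda>U. U \<subseteq> p ` topspace X \<and> openin X {x \<in> topspace X. p x \<in> U})"
    unfolding istopology_def
  proof (intro conjI allI impI)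
    fix U V
    assume "U \<subseteq> p ` topspace X \<and> openin X {x \<in> topspace X. p x \<in> U}"
      and "V \<subseteq> p ` topspace X \<and> openin X {x \<in> topspace X. p x \<in> V}"
    moreover have "{x \<in> topspace X. p x \<in> U \<inter> V} =
        {x \<in> topspace X. p x \<in> U} \<inter> {x \<in> topspace X. p x \<in> V}" by auto
    ultimately show "U \<inter> V \<subseteq> p ` topspace X" "openin X {x \<in> topspace X. p x \<in> U \<inter> V}"
      by auto
  next
    fix \<K>
    assume *: "\<forall>U\<in>\<K>. U \<subseteq> p ` topspace X \<and> openin X {x \<in> topspace X. p x \<in> U}"
    then show "\<Union>\<K> \<subseteq> p ` topspace X" by blast
    have "{x \<in> topspace X. p x \<in> \<Union>\<K>} = (\<Union>U\<in>\<K>. {x \<in> topspace X. p x \<in> U})" by auto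
    then show "openin X {x \<in> topspace X. p x \<in> \<Union>\<K>}" using * by auto
  qed
  then show ?thesis unfolding quotient_topology_def by (simp add: topology_inverse')
qed

lemma topspace_quotient_topology: "topspace (quotient_topology X p) = p ` topspace X"
proof
  show "topspace (quotient_topology X p) \<subseteq> p ` topspace X"
    unfolding topspace_def openin_quotient_topology by blast
  have "{x \<in> topspace X. p x \<in> p ` topspace X} = topspace X" by auto
  then show "p ` topspace X \<subseteq> topspace (quotient_topology X p)"
    by (intro openin_subset) (simp add: openin_quotient_topology)
qed

lemma quotient_map_quotient_topology: "quotient_map X (quotient_topology X p) p"
  unfolding quotient_map_def
  by (auto simp: topspace_quotient_topology openin_quotient_topology)

definition coset_topology ::
    "('k, 'm) monoid_scheme \<Rightarrow> 'k topology \<Rightarrow> 'k set \<Rightarrow> 'k set topology" where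
  "coset_topology G T H = quotient_topology T (\<lambda>k. k <#\<^bsub>G\<^esub> H)"

text \<open>The value on a left coset is computed from an arbitrary representative; the choice is
  irrelevant by \<open>coset_action_l_coset\<close>.\<close>

definition coset_action ::
    "('k, 'm) monoid_scheme \<Rightarrow> ('s \<Rightarrow> 'k \<Rightarrow> 'k) \<Rightarrow> 'k set \<Rightarrow> 's \<Rightarrow> 'k set \<Rightarrow> 'k set" where
  "coset_action G \<rho> H s C = \<rho> s (SOME k. k \<in> carrier G \<and> C = k <#\<^bsub>G\<^esub> H) <#\<^bsub>G\<^esub> H"

lemma topspace_coset_topology:
  assumes "topspace T = carrier G"
  shows "topspace (coset_topology G T H) = lcosets\<^bsub>G\<^esub> H"
  using assms
  by (auto simp: coset_topology_def topspace_quotient_topology LCOSETS_def)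

lemma coset_action_l_coset:
  assumes "group G" "subgroup H G" "right_group_action S G T \<rho>" "invariant_under S \<rho> H"
    and s: "s \<in> carrier S" and k: "k \<in> carrier G"
  shows "coset_action G \<rho> H s (k <#\<^bsub>G\<^esub> H) = \<rho> s k <#\<^bsub>G\<^esub> H"
proof -
  interpret group G by fact
  interpret H: subgroup H G by fact
  have hom: "\<rho> s \<in> hom G G"
    using assms(3) s unfolding right_group_action_def by blast
  define l where "l = (SOME l. l \<in> carrier G \<and> k <#\<^bsub>G\<^esub> H = l <#\<^bsub>G\<^esub> H)"
  have l: "l \<in> carrier G" "k <#\<^bsub>G\<^esub> H = l <#\<^bsub>G\<^esub> H"
    using someI[of "\<lambda>l. l \<in> carrier G \<and> k <#\<^bsub>G\<^esub> H = l <#\<^bsub>G\<^esub> H" k] k unfolding l_def by auto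
  have "l \<in> l <#\<^bsub>G\<^esub> H"
    using l(1) H.one_closed unfolding l_coset_def by force
  then obtain h where h: "h \<in> H" "l = k \<otimes>\<^bsub>G\<^esub> h"
    using l(2) unfolding l_coset_def by auto
  then have "\<rho> s l = \<rho> s k \<otimes>\<^bsub>G\<^esub> \<rho> s h"
    using hom k by (simp add: hom_mult)
  moreover have "\<rho> s h \<in> H"
    using assms(4) s h(1) unfolding invariant_under_def by blast
  ultimately have "\<rho> s l \<in> \<rho> s k <#\<^bsub>G\<^esub> H"
    unfolding l_coset_def by auto
  then have "\<rho> s k <#\<^bsub>G\<^esub> H = \<rho> s l <#\<^bsub>G\<^esub> H"
    using l_repr_independence[OF _ _ assms(2)] hom k by (simp add: hom_in_carrier)
  then show ?thesis unfolding coset_action_def l_def by simp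
qed

definition open_cover :: "'a topology \<Rightarrow> 'a set set \<Rightarrow> bool" where
  "open_cover X \<U> \<longleftrightarrow> (\<forall>U\<in>\<U>. openin X U) \<and> \<Union>\<U> = topspace X"

definition cover_number :: "'a topology \<Rightarrow> 'a set set \<Rightarrow> nat" where
  "cover_number X \<U> =
     (LEAST n. \<exists>\<V>\<subseteq>\<U>. finite \<V> \<and> \<Union>\<V> = topspace X \<and> card \<V> = n)"

definition cover_join :: "'a set set \<Rightarrow> 'a set set \<Rightarrow> 'a set set" where
  "cover_join \<U> \<V> = {U \<inter> V | U V. U \<in> \<U> \<and> V \<in> \<V>}"

definition cover_Join :: "'b set \<Rightarrow> ('b \<Rightarrow> 'a set set) \<Rightarrow> 'a set set" where
  "cover_Join A \<U> = {\<Inter>s\<in>A. V s | V. \<forall>s\<in>A. V s \<in> \<U> s}"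

lemma cover_Join_singleton: "cover_Join {a} \<U> = \<U> a"
proof -
  have "U \<in> cover_Join {a} \<U>" if "U \<in> \<U> a" for U
    unfolding cover_Join_def using that by (auto intro!: exI[of _ "\<lambda>_. U"])
  then show ?thesis unfolding cover_Join_def by auto
qed

lemma cover_Join_insert:
  assumes "a \<notin> A"
  shows "cover_Join (insert a A) \<U> = cover_join (\<U> a) (cover_Join A \<U>)"
proof
  show "cover_Join (insert a A) \<U> \<subseteq> cover_join (\<U> a) (cover_Join A \<U>)"
    unfolding cover_Join_def cover_join_def by auto
  show "cover_join (\<U> a) (cover_Join A \<U>) \<subseteq> cover_Join (insert a A) \<U>"
  proof
    fix W assume "W \<in> cover_join (\<U> a) (cover_Join A \<U>)"
    then obtain U V where UV: "U \<in> \<U> a" "\<forall>s\<in>A. V s \<in> \<U> s" "W = U \<inter> (\<Inter>s\<in>A. V s)"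
      unfolding cover_Join_def cover_join_def by auto
    have "W = (\<Inter>s\<in>insert a A. (V(a := U)) s)"
      using UV(3) assms by auto
    moreover have "\<forall>s\<in>insert a A. (V(a := U)) s \<in> \<U> s"
      using UV assms by auto
    ultimately show "W \<in> cover_Join (insert a A) \<U>"
      unfolding cover_Join_def by blast
  qed
qed

definition preimage_cover :: "'a topology \<Rightarrow> ('a \<Rightarrow> 'a) \<Rightarrow> 'a set set \<Rightarrow> 'a set set" where
  "preimage_cover X f \<U> = (\<lambda>U. {x \<in> topspace X. f x \<in> U}) ` \<U>"

definition cover_along ::
    "'a topology \<Rightarrow> ('s \<Rightarrow> 'a \<Rightarrow> 'a) \<Rightarrow> 'a set set \<Rightarrow> 's set \<Rightarrow> 'a set set" where
  "cover_along X \<rho> \<U> F = cover_Join F (\<lambda>s. preimage_cover X (\<rho> s) \<U>)"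

text \<open>The entropies carry the right Folner net \<open>F\<close>, indexed by \<open>(I, r)\<close>, along which the limit
  is taken.\<close>

definition H_top :: "'i set \<Rightarrow> 'i rel \<Rightarrow> ('i \<Rightarrow> 's set) \<Rightarrow> 'a topology \<Rightarrow>
    ('s \<Rightarrow> 'a \<Rightarrow> 'a) \<Rightarrow> 'a set set \<Rightarrow> real" where
  "H_top I r F X \<rho> \<U> =
     Lim (net_filter I r) (\<lambda>i. ln (real (cover_number X (cover_along X \<rho> \<U> (F i)))) / real (card (F i)))"

definition h_top :: "'i set \<Rightarrow> 'i rel \<Rightarrow> ('i \<Rightarrow> 's set) \<Rightarrow> 'a topology \<Rightarrow>
    ('s \<Rightarrow> 'a \<Rightarrow> 'a) \<Rightarrow> ereal" where
  "h_top I r F X \<rho> = (SUP \<U>\<in>{\<U>. open_cover X \<U>}. ereal (H_top I r F X \<rho> \<U>))"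

end

theory Submission
  imports Defs
begin

text \<open>Separated sets multiply: if \<open>B\<^sub>2 \<subseteq> K\<close> is separated modulo \<open>H\<close> and \<open>B\<^sub>1 \<subseteq> H\<close> is separated, then
  \<open>B\<^sub>2B\<^sub>1\<close> is separated in \<open>K\<close>, which gives \<open>\<ge>\<close> for every finite \<open>F \<subseteq> S\<close>. For \<open>\<le>\<close>, all cosets \<open>kH\<close>
  look alike because \<open>\<rho>\<^sub>s(kh) = \<rho>\<^sub>s(k)\<rho>\<^sub>s(h)\<close>. Fix finitely many \<open>E \<subseteq> S\<close>; an efficient cover of \<open>H\<close> by
  Bowen balls along each \<open>E\<close> covers a neighbourhood \<open>W\<close> of \<open>H\<close> in \<open>K\<close>. If \<open>F\<close> is tiled by translates
  \<open>cE\<close>, then on a Bowen ball of \<open>K/H\<close> along \<open>F\<close> at scale \<open>W\<close>, each tile costs as many choices as the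
  cover of \<open>H\<close> along its \<open>E\<close> has members. Folner sets are tiled up to a small proportion by the
  Ornstein-Weiss construction, which also gives the existence of the limits.\<close>

section \<open>Quasi-tilings of Folner sets\<close>

text \<open>Cover numbers are compared through separated and spanning sets, with closeness in K
  measured left-invariantly: y is close to x when x^-1 y lies in a small set. Since H need not be
  normal, K/H carries no group structure, and closeness of cosets is expressed in K by
  neighbourhoods W of H with HWH = W: then x^-1 y \<in> W depends only on xH and yH. Such W exist
  because H is compact. The obstacle to \<le> is uniformity. A cover of H by balls along F does
  cover a neighbourhood of H, but that neighbourhood shrinks with F, whereas the entropy of K/H is
  measured with one open cover for all F. Tiling reduces F to finitely many shapes E, so one
  neighbourhood serves every late F. The scale in H is fixed before the shapes, from the cover of K
  alone; the shapes are nearly optimal for the resulting cover of H, and the neighbourhood of H,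
  hence the cover of K/H, comes last. In a monoid a tile cE cannot be moved back by c^-1, so
  boundary estimates count the elements that leave a set under right multiplication, which is
  injective by cancellation.\<close>

context monoid_cancel
begin

text \<open>The right boundary \<open>(A #> e) - A\<close> pulled back along
  \<open>a \<mapsto> a \<otimes> e\<close>. Counting sources inside \<open>A\<close> instead of
  targets outside lets exits from unions and differences be compared by inclusions.\<close>

definition exits :: "'a set \<Rightarrow> 'a \<Rightarrow> 'a set" where
  "exits A e = {a \<in> A. a \<otimes> e \<notin> A}"

lemma card_exits:
  assumes "A \<subseteq> carrier G" "e \<in> carrier G"
  shows "card (exits A e) = card ((A #> e) - A)"
proof (rule bij_betw_same_card)
  show "bij_betw (\<lambda>a. a \<otimes> e) (exits A e) ((A #> e) - A)"
    unfolding bij_betw_def inj_on_def exits_def r_coset_def using assms r_cancel by blast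
qed

lemma inj_on_l_mult:
  assumes "c \<in> carrier G" "E \<subseteq> carrier G"
  shows "inj_on ((\<otimes>) c) E"
proof (rule inj_onI)
  fix x y assume "x \<in> E" "y \<in> E" "c \<otimes> x = c \<otimes> y"
  then show "x = y" using assms l_cancel[of c x y] by auto
qed

lemma card_l_translate:
  assumes "c \<in> carrier G" "E \<subseteq> carrier G"
  shows "card ((\<otimes>) c ` E) = card E"
  by (rule card_image[OF inj_on_l_mult[OF assms]])

text \<open>An element leaving \<open>A - B\<close> either leaves \<open>A\<close> or enters
  \<open>B\<close>. Right multiplication by \<open>e\<close> is injective, so the elements entering
  \<open>B\<close> (\<open>Y\<close>) and those staying in it (\<open>Z\<close>) number at most
  \<open>card B\<close> together, and \<open>B\<close> consists of \<open>Z\<close> and its exits: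
  entries into \<open>B\<close> from \<open>A - B\<close> never outnumber exits from
  \<open>B\<close>.\<close>

lemma card_exits_Diff_le:
  assumes "finite A" "A \<subseteq> carrier G" "B \<subseteq> A" "e \<in> carrier G"
  shows "card (exits (A - B) e) \<le> card (exits A e) + card (exits B e)"
proof -
  have finB: "finite B" using assms finite_subset by blast
  define Y where "Y = {a \<in> A - B. a \<otimes> e \<in> B}"
  define Z where "Z = {a \<in> B. a \<otimes> e \<in> B}"
  have "card Y + card Z = card (Y \<union> Z)"
    by (rule card_Un_disjoint[symmetric]) (use assms finB in \<open>auto simp: Y_def Z_def\<close>)
  also have "\<dots> \<le> card B"
  proof (rule card_inj_on_le)
    show "inj_on (\<lambda>a. a \<otimes> e) (Y \<union> Z)"
      unfolding inj_on_def Y_def Z_def using assms r_cancel by blast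
  qed (use finB in \<open>auto simp: Y_def Z_def\<close>)
  also have "B = Z \<union> exits B e" by (auto simp: Z_def exits_def)
  also have "card \<dots> = card Z + card (exits B e)"
    by (rule card_Un_disjoint) (use finB in \<open>auto simp: Z_def exits_def\<close>)
  finally have "card Y \<le> card (exits B e)" by simp
  moreover have "card (exits (A - B) e) \<le> card (exits A e \<union> Y)"
    by (rule card_mono) (use assms in \<open>auto simp: Y_def exits_def\<close>)
  moreover have "card (exits A e \<union> Y) \<le> card (exits A e) + card Y" by (rule card_Un_le)
  ultimately show ?thesis by simp
qed

text \<open>By associativity a point \<open>c \<otimes> b\<close> that leaves the whole union has
  \<open>c \<otimes> (b \<otimes> e)\<close> outside the tile at \<open>c\<close>, so
  \<open>b\<close> already exits \<open>E\<close>. Each tile therefore contributes at most the exits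
  of its shape.\<close>

lemma card_exits_translates_le:
  assumes "finite C" "C \<subseteq> carrier G" "finite E" "E \<subseteq> carrier G" "e \<in> carrier G"
  shows "card (exits (\<Union>c\<in>C. (\<otimes>) c ` E) e) \<le> card C * card (exits E e)"
proof -
  have fin: "finite (exits E e)" using assms by (simp add: exits_def)
  have "exits (\<Union>c\<in>C. (\<otimes>) c ` E) e \<subseteq> (\<Union>c\<in>C. (\<otimes>) c ` exits E e)"
  proof
    fix a assume "a \<in> exits (\<Union>c\<in>C. (\<otimes>) c ` E) e"
    then obtain c b where cb: "c \<in> C" "b \<in> E" "a = c \<otimes> b"
      and out: "a \<otimes> e \<notin> (\<Union>c\<in>C. (\<otimes>) c ` E)" by (auto simp: exits_def)
    have "a \<otimes> e = c \<otimes> (b \<otimes> e)"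
      using cb assms by (simp add: m_assoc subset_iff)
    then have "b \<otimes> e \<notin> E" using out cb(1) by auto
    then show "a \<in> (\<Union>c\<in>C. (\<otimes>) c ` exits E e)" using cb by (auto simp: exits_def)
  qed
  then have "card (exits (\<Union>c\<in>C. (\<otimes>) c ` E) e) \<le> card (\<Union>c\<in>C. (\<otimes>) c ` exits E e)"
    using assms fin by (intro card_mono) auto
  also have "\<dots> \<le> (\<Sum>c\<in>C. card ((\<otimes>) c ` exits E e))" by (rule card_UN_le) fact
  also have "\<dots> \<le> (\<Sum>c\<in>C. card (exits E e))" by (intro sum_mono card_image_le fin)
  finally show ?thesis by simp
qed

text \<open>Counting the pairs \<open>(a, e)\<close> with \<open>a \<otimes> e\<close> already covered shows that a maximal family of
  nearly disjoint translates covers a definite proportion of \<open>A\<close>.\<close>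

lemma ex_nearly_disjoint_translates:
  assumes A: "finite A" "A \<subseteq> carrier G" and E: "finite E" "E \<subseteq> carrier G" "E \<noteq> {}"
    and \<epsilon>: "0 < \<epsilon>" "\<epsilon> < 1"
    and inv: "real (\<Sum>e\<in>E. card (exits A e)) \<le> real (card A) / 2"
  shows "\<exists>C\<subseteq>A. (\<Union>c\<in>C. (\<otimes>) c ` E) \<subseteq> A \<and>
    (1 - \<epsilon>) * (real (card C) * real (card E)) \<le> real (card (\<Union>c\<in>C. (\<otimes>) c ` E)) \<and>
    \<epsilon> / 2 * real (card A) \<le> real (card (\<Union>c\<in>C. (\<otimes>) c ` E))"
proof -
  define T where "T = (\<lambda>C. \<Union>c\<in>C. (\<otimes>) c ` E)"
  \<comment> \<open>The centres whose whole translate stays inside \<open>A\<close>.\<close>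
  define A0 where "A0 = {a \<in> A. (\<otimes>) a ` E \<subseteq> A}"
  define P where "P = (\<lambda>C. C \<subseteq> A0 \<and> (1 - \<epsilon>) * (real (card C) * real (card E)) \<le> real (card (T C)))"
  have finA0: "finite A0" "A0 \<subseteq> A" using A by (auto simp: A0_def)
  have "P {}" by (simp add: P_def T_def)
  moreover have "\<forall>C. P C \<longrightarrow> card C < Suc (card A0)"
    unfolding P_def using finA0 by (meson card_mono le_imp_less_Suc)
  ultimately obtain C where C: "P C" and max: "\<And>C'. P C' \<Longrightarrow> card C' \<le> card C"
    using ex_has_greatest_nat[of P "{}" card "Suc (card A0)"] by blast
  have CA: "C \<subseteq> A0" "finite C" using C finA0 finite_subset unfolding P_def by blast+
  have TA: "T C \<subseteq> A" using CA unfolding T_def A0_def by blast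
  have finT: "finite (T C)" using TA A finite_subset by blast
  have ge: "\<epsilon> * real (card E) \<le> real (card ((\<otimes>) a ` E \<inter> T C))" if a: "a \<in> A0" for a
  proof -
    have ca: "card ((\<otimes>) a ` E) = card E"
      using a A E finA0 by (intro card_l_translate) auto
    show ?thesis
    proof (cases "a \<in> C")
      case True
      then have "(\<otimes>) a ` E \<inter> T C = (\<otimes>) a ` E" by (auto simp: T_def)
      then show ?thesis using ca \<epsilon> by (simp add: mult_left_le_one_le)
    next
      \<comment> \<open>Maximality of \<open>C\<close> forbids adding \<open>a\<close>, and this can
        only be due to overlap: the new translate must meet the covered part in at least the
        fraction \<epsilon> of its points.\<close>
      case False
      then have card_ins: "card (insert a C) = Suc (card C)" using CA by simp
      then have "\<not> P (insert a C)" using max by fastforce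
      then have less: "real (card (T (insert a C))) < (1 - \<epsilon>) * (real (Suc (card C)) * real (card E))"
        using a CA card_ins unfolding P_def by auto
      have "T (insert a C) = T C \<union> ((\<otimes>) a ` E - T C)" by (auto simp: T_def)
      moreover have "card (T C \<union> ((\<otimes>) a ` E - T C)) = card (T C) + card ((\<otimes>) a ` E - T C)"
        using finT E by (intro card_Un_disjoint) auto
      ultimately have "card (T (insert a C)) = card (T C) + card ((\<otimes>) a ` E - T C)" by simp
      moreover have "card ((\<otimes>) a ` E - T C) + card ((\<otimes>) a ` E \<inter> T C) = card E"
        using card_Diff_subset_Int[of "(\<otimes>) a ` E" "T C"] finT ca
          card_mono[of "(\<otimes>) a ` E" "(\<otimes>) a ` E \<inter> T C"] E by simp
      then have "real (card ((\<otimes>) a ` E - T C)) = real (card E) - real (card ((\<otimes>) a ` E \<inter> T C))"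
        by linarith
      ultimately show ?thesis using less C unfolding P_def by (simp add: algebra_simps)
    qed
  qed
  \<comment> \<open>Double counting of the pairs \<open>(a, e)\<close> with
    \<open>a \<otimes> e \<in> T C\<close>: at least \<epsilon> |E| for each
    \<open>a \<in> A0\<close>, at most |T C| for each \<open>e\<close> by right
    cancellation.\<close>
  have "\<epsilon> * real (card E) * real (card A0) \<le> (\<Sum>a\<in>A0. real (card ((\<otimes>) a ` E \<inter> T C)))"
    using sum_mono[OF ge] by (simp add: mult.commute)
  also have "\<dots> \<le> (\<Sum>a\<in>A0. \<Sum>e\<in>E. if a \<otimes> e \<in> T C then 1 else 0)"
  proof (rule sum_mono)
    fix a
    have "card ((\<otimes>) a ` E \<inter> T C) \<le> card ((\<otimes>) a ` {e \<in> E. a \<otimes> e \<in> T C})"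
      using E by (intro card_mono) auto
    also have "\<dots> \<le> card {e \<in> E. a \<otimes> e \<in> T C}" using E by (intro card_image_le) auto
    finally show "real (card ((\<otimes>) a ` E \<inter> T C)) \<le> (\<Sum>e\<in>E. if a \<otimes> e \<in> T C then 1 else 0)"
      using E by (simp add: sum.If_cases Int_def)
  qed
  also have "\<dots> = (\<Sum>e\<in>E. \<Sum>a\<in>A0. if a \<otimes> e \<in> T C then 1 else 0)" by (rule sum.swap)
  also have "\<dots> \<le> (\<Sum>e\<in>E. real (card (T C)))"
  proof (rule sum_mono)
    fix e assume e: "e \<in> E"
    have "card {a \<in> A0. a \<otimes> e \<in> T C} \<le> card (T C)"
    proof (rule card_inj_on_le)
      show "inj_on (\<lambda>a. a \<otimes> e) {a \<in> A0. a \<otimes> e \<in> T C}"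
        unfolding inj_on_def using A E e finA0 r_cancel by blast
    qed (use finT in auto)
    then show "(\<Sum>a\<in>A0. if a \<otimes> e \<in> T C then 1 else 0) \<le> real (card (T C))"
      using finA0 by (simp add: sum.If_cases Int_def)
  qed
  finally have "real (card E) * (\<epsilon> * real (card A0)) \<le> real (card E) * real (card (T C))"
    by (simp add: algebra_simps)
  then have T_ge: "\<epsilon> * real (card A0) \<le> real (card (T C))"
    using E by (simp add: card_gt_0_iff)
  \<comment> \<open>A centre fails to lie in \<open>A0\<close> only by exiting \<open>A\<close>
    under some \<open>e \<in> E\<close>. The assumption \<open>inv\<close> bounds these failures by
    half of \<open>A\<close>, which is the origin of \<epsilon>/2.\<close>
  have "A \<subseteq> A0 \<union> (\<Union>e\<in>E. exits A e)" by (auto simp: A0_def exits_def)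
  then have "card A \<le> card (A0 \<union> (\<Union>e\<in>E. exits A e))"
    using A E by (intro card_mono) (auto simp: A0_def exits_def)
  also have "\<dots> \<le> card A0 + card (\<Union>e\<in>E. exits A e)" by (rule card_Un_le)
  also have "\<dots> \<le> card A0 + (\<Sum>e\<in>E. card (exits A e))" using E by (simp add: card_UN_le)
  finally have "real (card A) \<le> real (card A0) + real (\<Sum>e\<in>E. card (exits A e))"
    by linarith
  then have "real (card A) / 2 \<le> real (card A0)" using inv by linarith
  then have "\<epsilon> * (real (card A) / 2) \<le> \<epsilon> * real (card A0)"
    using \<epsilon> by (intro mult_left_mono) auto
  then have "\<epsilon> / 2 * real (card A) \<le> real (card (T C))" using T_ge by simp
  moreover have "C \<subseteq> A" using CA finA0 by auto
  moreover have "(1 - \<epsilon>) * (real (card C) * real (card E)) \<le> real (card (T C))"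
    using C by (simp add: P_def)
  ultimately show ?thesis using TA unfolding T_def by (intro exI[of _ C]) simp
qed

text \<open>A tile is a pair of a centre and a shape. Overlaps are limited in total: by the last
  conjunct the tile sizes, counted with multiplicity, exceed the size of \<open>A\<close> at most by
  the factor 1/(1 - \<epsilon>). This is what an estimate of costs proportional to tile size calls
  for.\<close>

definition quasi_tiles :: "real \<Rightarrow> 'a set set \<Rightarrow> 'a set \<Rightarrow> ('a \<times> 'a set) set \<Rightarrow> bool" where
  "quasi_tiles \<epsilon> \<E> A Q \<longleftrightarrow> Q \<subseteq> A \<times> \<E> \<and> (\<Union>(c, E)\<in>Q. (\<otimes>) c ` E) \<subseteq> A \<and>
     (1 - \<epsilon>) * (\<Sum>(c, E)\<in>Q. real (card E)) \<le> real (card A)"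

text \<open>The shape added at stage \<open>Suc n\<close> is much more invariant than the earlier
  ones require, and it is placed before them: its nearly disjoint translates use up a fraction
  \<epsilon>/2 of \<open>A\<close>, while the rest of \<open>A\<close> stays invariant enough to be
  tiled by the earlier shapes. The uncovered fraction thus shrinks by 1 - \<epsilon>/2 per shape.
  The \<open>max\<close> with \<epsilon> reflects the stopping rule: once the rest is below
  \<epsilon> |A|, its boundary is no longer controlled relative to its own size. Shapes come from an
  arbitrary class \<C> with arbitrarily invariant members, so that they can also be chosen
  cheap.\<close>

lemma quasi_tiling:
  assumes \<epsilon>: "0 < \<epsilon>" "\<epsilon> < 1/2"
    and inv: "\<forall>D \<eta>. finite D \<longrightarrow> D \<subseteq> carrier G \<longrightarrow> \<eta> > 0 \<longrightarrow>
      (\<exists>E\<in>\<C>. E \<noteq> {} \<and> finite E \<and> E \<subseteq> carrier G \<and>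
        (\<forall>e\<in>D. real (card (exits E e)) \<le> \<eta> * real (card E)))"
  shows "\<exists>\<E> D \<eta>. finite \<E> \<and> \<E> \<subseteq> \<C> \<and> (\<forall>E\<in>\<E>. E \<noteq> {} \<and> finite E \<and> E \<subseteq> carrier G) \<and>
    finite D \<and> D \<subseteq> carrier G \<and> \<eta> > 0 \<and>
    (\<forall>A. finite A \<longrightarrow> A \<subseteq> carrier G \<longrightarrow> (\<forall>e\<in>D. real (card (exits A e)) \<le> \<eta> * real (card A)) \<longrightarrow>
      (\<exists>Q. quasi_tiles \<epsilon> \<E> A Q \<and>
         real (card (A - (\<Union>(c, E)\<in>Q. (\<otimes>) c ` E))) \<le> max \<epsilon> ((1 - \<epsilon> / 2) ^ n) * real (card A)))"
proof (induction n)
  case 0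
  have "\<exists>Q. quasi_tiles \<epsilon> {} A Q \<and>
     real (card (A - (\<Union>(c, E)\<in>Q. (\<otimes>) c ` E))) \<le> max \<epsilon> ((1 - \<epsilon> / 2) ^ 0) * real (card A)" for A
    using \<epsilon> by (intro exI[of _ "{}"]) (auto simp: quasi_tiles_def)
  then show ?case
    by (intro exI[of _ "{}"] exI[of _ "1::real"]) auto
next
  case (Suc n)
  obtain \<E> D \<eta> where \<E>: "finite \<E>" "\<E> \<subseteq> \<C>" "\<And>E. E \<in> \<E> \<Longrightarrow> E \<noteq> {} \<and> finite E \<and> E \<subseteq> carrier G"
    and D: "finite D" "D \<subseteq> carrier G" "\<eta> > 0"
    and IH: "\<And>A. finite A \<Longrightarrow> A \<subseteq> carrier G \<Longrightarrow>
        (\<forall>e\<in>D. real (card (exits A e)) \<le> \<eta> * real (card A)) \<Longrightarrow>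
      (\<exists>Q. quasi_tiles \<epsilon> \<E> A Q \<and>
         real (card (A - (\<Union>(c, E)\<in>Q. (\<otimes>) c ` E))) \<le> max \<epsilon> ((1 - \<epsilon> / 2) ^ n) * real (card A))"
    using Suc.IH by (elim exE conjE) blast
  obtain E where E: "E \<in> \<C>" "E \<noteq> {}" "finite E" "E \<subseteq> carrier G"
    and Einv: "\<And>e. e \<in> D \<Longrightarrow> real (card (exits E e)) \<le> \<eta> * \<epsilon> / 4 * real (card E)"
    using inv[rule_format, OF D(1,2), of "\<eta> * \<epsilon> / 4"] D(3) \<epsilon> by auto
  \<comment> \<open>The first term leaves room for the boundary of the rest; the second makes the
    exits from \<open>A\<close> over all of \<open>E\<close> add up to at most half of
    \<open>A\<close>, as the covering step requires.\<close>
  define \<eta>' where "\<eta>' = min (\<eta> * \<epsilon> / 2) (1 / (2 * real (card E)))"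
  have cE: "card E > 0" using E by (simp add: card_gt_0_iff)
  have \<eta>': "\<eta>' > 0" "\<eta>' \<le> \<eta> * \<epsilon> / 2" "\<eta>' * real (card E) \<le> 1 / 2"
  proof -
    show "\<eta>' > 0" "\<eta>' \<le> \<eta> * \<epsilon> / 2" using D \<epsilon> cE by (auto simp: \<eta>'_def)
    have "\<eta>' * real (card E) \<le> 1 / (2 * real (card E)) * real (card E)"
      by (intro mult_right_mono) (auto simp: \<eta>'_def)
    then show "\<eta>' * real (card E) \<le> 1 / 2" using cE by simp
  qed
  have main: "\<exists>Q. quasi_tiles \<epsilon> (insert E \<E>) A Q \<and>
         real (card (A - (\<Union>(c, E)\<in>Q. (\<otimes>) c ` E))) \<le> max \<epsilon> ((1 - \<epsilon> / 2) ^ Suc n) * real (card A)"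
    if A: "finite A" "A \<subseteq> carrier G"
      and Ainv: "\<forall>e\<in>D \<union> E. real (card (exits A e)) \<le> \<eta>' * real (card A)" for A
  proof -
    have "real (\<Sum>e\<in>E. card (exits A e)) = (\<Sum>e\<in>E. real (card (exits A e)))" by simp
    also have "\<dots> \<le> (\<Sum>e\<in>E. \<eta>' * real (card A))" using Ainv by (intro sum_mono) auto
    also have "\<dots> = (\<eta>' * real (card E)) * real (card A)" by simp
    also have "\<dots> \<le> 1 / 2 * real (card A)" using \<eta>' by (intro mult_right_mono) auto
    finally have half: "real (\<Sum>e\<in>E. card (exits A e)) \<le> real (card A) / 2" by simp
    obtain C where C: "C \<subseteq> A" and CE: "(\<Union>c\<in>C. (\<otimes>) c ` E) \<subseteq> A"
      and small: "(1 - \<epsilon>) * (real (card C) * real (card E)) \<le> real (card (\<Union>c\<in>C. (\<otimes>) c ` E))"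
      and large: "\<epsilon> / 2 * real (card A) \<le> real (card (\<Union>c\<in>C. (\<otimes>) c ` E))"
      using ex_nearly_disjoint_translates[OF A E(3,4,2) \<epsilon>(1) _ half] \<epsilon> by auto
    define B where "B = (\<Union>c\<in>C. (\<otimes>) c ` E)"
    have finC: "finite C" using C A finite_subset by blast
    have finB: "finite B" and BA: "B \<subseteq> A" using CE A finite_subset unfolding B_def by blast+
    have card_diff: "real (card (A - B)) = real (card A) - real (card B)"
      using finB BA A by (simp add: card_Diff_subset card_mono of_nat_diff)
    define Q0 where "Q0 = C \<times> {E}"
    have Q0: "(\<Union>(c, E)\<in>Q0. (\<otimes>) c ` E) = B" by (auto simp: Q0_def B_def)
    have Q0s: "(\<Sum>(c, E)\<in>Q0. real (card E)) = real (card C) * real (card E)"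
      by (simp add: Q0_def sum.cartesian_product[symmetric])
    show ?thesis
    proof (cases "real (card (A - B)) \<le> \<epsilon> * real (card A)")
      case True
      have "quasi_tiles \<epsilon> (insert E \<E>) A Q0"
        unfolding quasi_tiles_def Q0 Q0s
        using C BA small card_mono[OF A(1) BA] unfolding Q0_def B_def by auto
      moreover have "real (card (A - B)) \<le> max \<epsilon> ((1 - \<epsilon> / 2) ^ Suc n) * real (card A)"
        using True by (rule order_trans) (intro mult_right_mono, auto)
      ultimately show ?thesis using Q0 by (intro exI[of _ Q0]) simp
    next
      case False
      have "\<forall>e\<in>D. real (card (exits (A - B) e)) \<le> \<eta> * real (card (A - B))"
      proof
        fix e assume e: "e \<in> D"
        then have eG: "e \<in> carrier G" using D by blast
        have "card (exits (A - B) e) \<le> card (exits A e) + card (exits B e)"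
          by (rule card_exits_Diff_le[OF A BA eG])
        also have "card (exits B e) \<le> card C * card (exits E e)"
          unfolding B_def by (rule card_exits_translates_le) (use finC C A E eG in auto)
        finally have "real (card (exits (A - B) e)) \<le> real (card (exits A e)) + real (card C) * real (card (exits E e))"
          by (simp flip: of_nat_mult of_nat_add)
        also have "\<dots> \<le> \<eta>' * real (card A) + real (card C) * (\<eta> * \<epsilon> / 4 * real (card E))"
          using Ainv e Einv[OF e] by (intro add_mono mult_left_mono) auto
        \<comment> \<open>The bound \<epsilon> < 1/2 gives |C| |E| \<le> 2|A|. The constants \<eta>
          \<epsilon>/2 and \<eta> \<epsilon>/4 make the two terms add up to \<eta> \<epsilon> |A|,
          which in this case lies below \<eta> |A - B|.\<close>
        also have "\<dots> \<le> \<eta> * \<epsilon> / 2 * real (card A) + \<eta> * \<epsilon> / 4 * (2 * real (card A))"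
        proof (intro add_mono mult_right_mono)
          have "1 / 2 * (real (card C) * real (card E)) \<le> (1 - \<epsilon>) * (real (card C) * real (card E))"
            using \<epsilon> by (intro mult_right_mono) auto
          also have "\<dots> \<le> real (card A)" using small card_mono[OF A(1) BA] unfolding B_def by linarith
          finally have "real (card C) * real (card E) \<le> 2 * real (card A)" by simp
          then have "\<eta> * \<epsilon> / 4 * (real (card C) * real (card E)) \<le> \<eta> * \<epsilon> / 4 * (2 * real (card A))"
            using D \<epsilon> by (intro mult_left_mono) auto
          then show "real (card C) * (\<eta> * \<epsilon> / 4 * real (card E)) \<le> \<eta> * \<epsilon> / 4 * (2 * real (card A))"
            by (simp add: algebra_simps)
        qed (use \<eta>' in auto)
        also have "\<dots> = \<eta> * (\<epsilon> * real (card A))" by simp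
        also have "\<dots> \<le> \<eta> * real (card (A - B))" using False D by (intro mult_left_mono) auto
        finally show "real (card (exits (A - B) e)) \<le> \<eta> * real (card (A - B))" .
      qed
      then obtain Q where Q: "quasi_tiles \<epsilon> \<E> (A - B) Q"
        "real (card (A - B - (\<Union>(c, E)\<in>Q. (\<otimes>) c ` E))) \<le> max \<epsilon> ((1 - \<epsilon> / 2) ^ n) * real (card (A - B))"
        using IH[of "A - B"] A by auto
      have "Q \<subseteq> (A - B) \<times> \<E>" using Q(1) unfolding quasi_tiles_def by blast
      moreover have "finite ((A - B) \<times> \<E>)" using A \<E>(1) by simp
      ultimately have finQ: "finite Q" by (rule finite_subset)
      have "(\<Sum>(c, E)\<in>Q0 \<union> Q. real (card E)) \<le> (\<Sum>(c, E)\<in>Q0. real (card E)) + (\<Sum>(c, E)\<in>Q. real (card E))"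
      proof -
        have "finite Q0" using finC by (simp add: Q0_def)
        then have "(\<Sum>(c, E)\<in>Q0 \<union> Q. real (card E)) = (\<Sum>(c, E)\<in>Q0. real (card E)) +
            (\<Sum>(c, E)\<in>Q. real (card E)) - (\<Sum>(c, E)\<in>Q0 \<inter> Q. real (card E))"
          using finQ by (rule sum_Un)
        moreover have "0 \<le> (\<Sum>(c, E)\<in>Q0 \<inter> Q. real (card E))" by (intro sum_nonneg) auto
        ultimately show ?thesis by linarith
      qed
      then have "(1 - \<epsilon>) * (\<Sum>(c, E)\<in>Q0 \<union> Q. real (card E)) \<le>
          (1 - \<epsilon>) * ((\<Sum>(c, E)\<in>Q0. real (card E)) + (\<Sum>(c, E)\<in>Q. real (card E)))"
        using \<epsilon> by (intro mult_left_mono) auto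
      also have "\<dots> \<le> real (card B) + real (card (A - B))"
        using small Q(1) unfolding Q0s quasi_tiles_def B_def by (simp add: distrib_left)
      finally have "(1 - \<epsilon>) * (\<Sum>(c, E)\<in>Q0 \<union> Q. real (card E)) \<le> real (card A)"
        using card_diff by simp
      moreover have "Q0 \<union> Q \<subseteq> A \<times> insert E \<E>"
        using Q(1) C unfolding quasi_tiles_def Q0_def by auto
      moreover have "(\<Union>(c, E)\<in>Q0 \<union> Q. (\<otimes>) c ` E) \<subseteq> A"
      proof -
        have "(\<Union>(c, E)\<in>Q. (\<otimes>) c ` E) \<subseteq> A - B" using Q(1) unfolding quasi_tiles_def by blast
        then show ?thesis unfolding UN_Un Q0 using BA by (meson Diff_subset Un_least order_trans)
      qed
      ultimately have tiles: "quasi_tiles \<epsilon> (insert E \<E>) A (Q0 \<union> Q)"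
        unfolding quasi_tiles_def by blast
      have rest: "A - (\<Union>(c, E)\<in>Q0 \<union> Q. (\<otimes>) c ` E) = A - B - (\<Union>(c, E)\<in>Q. (\<otimes>) c ` E)"
        unfolding UN_Un Q0 by (rule Diff_Un[THEN trans]) auto
      \<comment> \<open>The factor gained from \<open>B\<close> raises the exponent by one; where
        the \<open>max\<close> equals \<epsilon>, it is simply dropped.\<close>
      have "max \<epsilon> ((1 - \<epsilon> / 2) ^ n) * (1 - \<epsilon> / 2) \<le> max \<epsilon> ((1 - \<epsilon> / 2) ^ Suc n)"
      proof -
        have "\<epsilon> * (1 - \<epsilon> / 2) \<le> \<epsilon>" using \<epsilon> by (simp add: algebra_simps)
        moreover have "max \<epsilon> ((1 - \<epsilon> / 2) ^ n) * (1 - \<epsilon> / 2) =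
            max (\<epsilon> * (1 - \<epsilon> / 2)) ((1 - \<epsilon> / 2) ^ n * (1 - \<epsilon> / 2))"
          using \<epsilon> by (simp only: max_mult_distrib_right) simp
        ultimately show ?thesis unfolding power_Suc2 by (metis max.mono order_refl)
      qed
      then have "max \<epsilon> ((1 - \<epsilon> / 2) ^ n) * ((1 - \<epsilon> / 2) * real (card A))
          \<le> max \<epsilon> ((1 - \<epsilon> / 2) ^ Suc n) * real (card A)"
        unfolding mult.assoc[symmetric] by (intro mult_right_mono) auto
      moreover have "real (card (A - B)) \<le> (1 - \<epsilon> / 2) * real (card A)"
        using large card_diff unfolding B_def by (simp add: algebra_simps)
      then have "max \<epsilon> ((1 - \<epsilon> / 2) ^ n) * real (card (A - B))
          \<le> max \<epsilon> ((1 - \<epsilon> / 2) ^ n) * ((1 - \<epsilon> / 2) * real (card A))"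
        using \<epsilon> by (intro mult_left_mono) (auto simp: max_def)
      ultimately have "real (card (A - (\<Union>(c, E)\<in>Q0 \<union> Q. (\<otimes>) c ` E)))
          \<le> max \<epsilon> ((1 - \<epsilon> / 2) ^ Suc n) * real (card A)"
        unfolding rest using Q(2) by linarith
      with tiles show ?thesis by blast
    qed
  qed
  show ?case
  proof (intro exI[of _ "insert E \<E>"] exI[of _ "D \<union> E"] exI[of _ \<eta>'] conjI)
    show "\<forall>A. finite A \<longrightarrow> A \<subseteq> carrier G \<longrightarrow>
      (\<forall>e\<in>D \<union> E. real (card (exits A e)) \<le> \<eta>' * real (card A)) \<longrightarrow>
      (\<exists>Q. quasi_tiles \<epsilon> (insert E \<E>) A Q \<and>
         real (card (A - (\<Union>(c, E)\<in>Q. (\<otimes>) c ` E))) \<le> max \<epsilon> ((1 - \<epsilon> / 2) ^ Suc n) * real (card A))"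
      using main by blast
  qed (use \<E> E D \<eta>' in auto)
qed

end

section \<open>Folner nets: exact tilings of bounded cost and the Ornstein-Weiss limit\<close>

lemma net_filter_neq_bot:
  assumes "directed_preorder I r"
  shows "net_filter I r \<noteq> bot"
proof
  assume "net_filter I r = bot"
  then have "eventually (\<lambda>_. False) (net_filter I r)" by simp
  then obtain i where "i \<in> I" "\<forall>j\<in>I. (i, j) \<in> r \<longrightarrow> False"
    unfolding eventually_net_filter[OF assms] by blast
  moreover have "(i, i) \<in> r"
    using assms \<open>i \<in> I\<close> unfolding directed_preorder_def preorder_on_def refl_on_def by blast
  ultimately show False by blast
qed

lemma eventually_in_net:
  assumes "directed_preorder I r"
  shows "eventually (\<lambda>i. i \<in> I) (net_filter I r)"
  unfolding eventually_net_filter[OF assms] using assms unfolding directed_preorder_def by blast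

context monoid_cancel
begin

text \<open>The Folner condition concerns one element at a time; finitely many are handled together
  because finite conjunctions of eventual properties are eventual. The side conditions on
  \<open>F i\<close> are carried along for the filter arguments.\<close>

lemma folner_eventually_exits_le:
  assumes net: "right_folner_net G I r F" and D: "finite D" "D \<subseteq> carrier G" and \<eta>: "\<eta> > 0"
  shows "eventually (\<lambda>i. i \<in> I \<and> F i \<noteq> {} \<and> finite (F i) \<and> F i \<subseteq> carrier G \<and>
      (\<forall>e\<in>D. real (card (exits (F i) e)) \<le> \<eta> * real (card (F i)))) (net_filter I r)"
proof -
  have dir: "directed_preorder I r"
    and F: "\<And>i. i \<in> I \<Longrightarrow> F i \<noteq> {} \<and> finite (F i) \<and> F i \<subseteq> carrier G"
    and lim: "\<And>s. s \<in> carrier G \<Longrightarrow>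
        ((\<lambda>i. real (card ((F i #> s) - F i)) / real (card (F i))) \<longlongrightarrow> 0) (net_filter I r)"
    using net unfolding right_folner_net_def by auto
  have "eventually (\<lambda>i. \<forall>e\<in>D. real (card ((F i #> e) - F i)) / real (card (F i)) < \<eta>) (net_filter I r)"
    using D lim \<eta> by (intro eventually_ball_finite ballI order_tendstoD(2)[of _ 0]) auto
  then show ?thesis
    using eventually_in_net[OF dir]
  proof eventually_elim
    case (elim i)
    have Fi: "F i \<noteq> {}" "finite (F i)" "F i \<subseteq> carrier G" using F elim by auto
    have "real (card (exits (F i) e)) \<le> \<eta> * real (card (F i))" if "e \<in> D" for e
    proof -
      have "card (F i) > 0" using Fi by (simp add: card_gt_0_iff)
      then show ?thesis
        using elim(1) that D card_exits[OF Fi(3), of e]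
        by (fastforce simp: pos_divide_less_eq intro: less_imp_le)
    qed
    then show ?case using elim Fi by blast
  qed
qed

text \<open>Sets costing at most \<open>l\<close> per element occur frequently along the net, hence
  among arbitrarily invariant sets, so the shapes of a quasi-tiling can be drawn from them. The few
  points it leaves become translates of \<open>{\<one>}\<close>, which makes the cover of
  \<open>F i\<close> exact at a cost of \<open>f {\<one>}\<close> for each. It serves both the
  existence of limits and the upper bound for the entropy of K.\<close>

lemma folner_tiling:
  assumes net: "right_folner_net G I r F"
    and nonneg: "\<forall>E. E \<noteq> {} \<longrightarrow> finite E \<longrightarrow> E \<subseteq> carrier G \<longrightarrow> 0 \<le> f E"
    and freq: "frequently (\<lambda>i. f (F i) \<le> l * real (card (F i))) (net_filter I r)"
    and l: "0 \<le> l" and \<delta>: "\<delta> > 0"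
  shows "\<exists>\<E>. finite \<E> \<and> (\<forall>E\<in>\<E>. E \<noteq> {} \<and> finite E \<and> E \<subseteq> carrier G) \<and>
    eventually (\<lambda>i. \<exists>Q\<subseteq>F i \<times> \<E>. finite Q \<and> F i = (\<Union>(c, E)\<in>Q. (\<otimes>) c ` E) \<and>
      (\<Sum>(c, E)\<in>Q. f E) \<le> (l + \<delta>) * real (card (F i))) (net_filter I r)"
proof -
  define M where "M = f {\<one>}"
  have M: "0 \<le> M" unfolding M_def using nonneg by simp
  \<comment> \<open>Overlaps cost the factor 1/(1 - \<epsilon>) \<le> 1 + 2\<epsilon> and leftover
    points cost \<epsilon> M per element of \<open>A\<close>, an excess of at most \<epsilon> (2l +
    M) \<le> \<delta>. The summand 1 keeps the denominator positive, and 1/4 ensures \<epsilon> <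
    1/2.\<close>
  define \<epsilon> where "\<epsilon> = min (1/4) (\<delta> / (2 * l + M + 1))"
  have \<epsilon>: "0 < \<epsilon>" "\<epsilon> < 1/2" using \<delta> l M by (auto simp: \<epsilon>_def)
  have small: "l / (1 - \<epsilon>) + \<epsilon> * M \<le> l + \<delta>"
  proof -
    have "1 \<le> (1 + 2 * \<epsilon>) * (1 - \<epsilon>)" using \<epsilon> mult_left_mono[of "2 * \<epsilon>" 1 \<epsilon>] by (simp add: algebra_simps)
    then have "l * 1 \<le> l * ((1 + 2 * \<epsilon>) * (1 - \<epsilon>))" using l by (intro mult_left_mono)
    then have "l / (1 - \<epsilon>) \<le> l * (1 + 2 * \<epsilon>)" using \<epsilon> by (simp add: field_simps)
    moreover have "\<epsilon> * (2 * l + M + 1) \<le> \<delta> / (2 * l + M + 1) * (2 * l + M + 1)"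
      using l M by (intro mult_right_mono) (auto simp: \<epsilon>_def)
    then have "\<epsilon> * (2 * l + M + 1) \<le> \<delta>" using l M by simp
    ultimately show ?thesis using \<epsilon> by (simp add: algebra_simps)
  qed
  obtain n where n: "(1 - \<epsilon> / 2) ^ n < \<epsilon>"
    using real_arch_pow_inv[of \<epsilon> "1 - \<epsilon> / 2"] \<epsilon> by auto
  define \<C> where "\<C> = {E. E \<noteq> {} \<and> finite E \<and> E \<subseteq> carrier G \<and> f E \<le> l * real (card E)}"
  have "\<exists>E\<in>\<C>. E \<noteq> {} \<and> finite E \<and> E \<subseteq> carrier G \<and>
        (\<forall>e\<in>D. real (card (exits E e)) \<le> \<eta> * real (card E))"
    if "finite D" "D \<subseteq> carrier G" "\<eta> > 0" for D \<eta>
  proof -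
    have "frequently (\<lambda>i. (i \<in> I \<and> F i \<noteq> {} \<and> finite (F i) \<and>
        F i \<subseteq> carrier G \<and> (\<forall>e\<in>D. real (card (exits (F i) e)) \<le> \<eta> * real (card (F i)))) \<and>
        f (F i) \<le> l * real (card (F i))) (net_filter I r)"
      by (rule frequently_eventually_conj[OF freq folner_eventually_exits_le[OF net that]])
    then obtain i where "(i \<in> I \<and> F i \<noteq> {} \<and> finite (F i) \<and>
        F i \<subseteq> carrier G \<and> (\<forall>e\<in>D. real (card (exits (F i) e)) \<le> \<eta> * real (card (F i)))) \<and>
        f (F i) \<le> l * real (card (F i))"
      by (blast dest: frequently_ex)
    then show ?thesis by (intro bexI[of _ "F i"]) (auto simp: \<C>_def)
  qed
  then have inv': "\<forall>D \<eta>. finite D \<longrightarrow> D \<subseteq> carrier G \<longrightarrow> \<eta> > 0 \<longrightarrow>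
      (\<exists>E\<in>\<C>. E \<noteq> {} \<and> finite E \<and> E \<subseteq> carrier G \<and>
        (\<forall>e\<in>D. real (card (exits E e)) \<le> \<eta> * real (card E)))" by blast
  from quasi_tiling[OF \<epsilon> inv', where n = n]
  obtain \<E> D \<eta> where \<E>: "finite \<E>" "\<E> \<subseteq> \<C>"
    and D: "finite D" "D \<subseteq> carrier G" "\<eta> > 0"
    and tile: "\<And>A. finite A \<Longrightarrow> A \<subseteq> carrier G \<Longrightarrow> (\<forall>e\<in>D. real (card (exits A e)) \<le> \<eta> * real (card A)) \<Longrightarrow>
      (\<exists>Q. quasi_tiles \<epsilon> \<E> A Q \<and>
         real (card (A - (\<Union>(c, E)\<in>Q. (\<otimes>) c ` E))) \<le> max \<epsilon> ((1 - \<epsilon> / 2) ^ n) * real (card A))"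
    by (elim exE conjE) blast
  have "\<exists>Q\<subseteq>A \<times> insert {\<one>} \<E>. finite Q \<and> A = (\<Union>(c, E)\<in>Q. (\<otimes>) c ` E) \<and>
      (\<Sum>(c, E)\<in>Q. f E) \<le> (l + \<delta>) * real (card A)"
    if A: "finite A" "A \<subseteq> carrier G" "\<forall>e\<in>D. real (card (exits A e)) \<le> \<eta> * real (card A)" for A
  proof -
    obtain Q where Q: "quasi_tiles \<epsilon> \<E> A Q"
      and rest: "real (card (A - (\<Union>(c, E)\<in>Q. (\<otimes>) c ` E))) \<le> max \<epsilon> ((1 - \<epsilon> / 2) ^ n) * real (card A)"
      using tile[OF A] by blast
    define R where "R = A - (\<Union>(c, E)\<in>Q. (\<otimes>) c ` E)"
    have R: "real (card R) \<le> \<epsilon> * real (card A)" "R \<subseteq> A" "finite R"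
      using rest n A(1) unfolding R_def by (auto simp: max_def)
    have QA: "Q \<subseteq> A \<times> \<E>" and TA: "(\<Union>(c, E)\<in>Q. (\<otimes>) c ` E) \<subseteq> A"
      using Q unfolding quasi_tiles_def by blast+
    have finQ: "finite Q" using QA A(1) \<E>(1) by (meson finite_SigmaI finite_subset)
    define Q' where "Q' = Q \<union> R \<times> {{\<one>}}"
    have "(\<Union>(c, E)\<in>R \<times> {{\<one>}}. (\<otimes>) c ` E) = (\<lambda>c. c \<otimes> \<one>) ` R" by auto
    also have "\<dots> = R" using R(2) A(2) by (force simp: image_iff)
    finally have "(\<Union>(c, E)\<in>Q'. (\<otimes>) c ` E) = (\<Union>(c, E)\<in>Q. (\<otimes>) c ` E) \<union> R"
      unfolding Q'_def UN_Un by simp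
    then have eq: "(\<Union>(c, E)\<in>Q'. (\<otimes>) c ` E) = A"
      using TA unfolding R_def by (simp only: Un_Diff_cancel Un_absorb1)
    have "(\<Sum>(c, E)\<in>Q'. f E) \<le> (\<Sum>(c, E)\<in>Q. f E) + (\<Sum>(c, E)\<in>R \<times> {{\<one>}}. f E)"
    proof -
      have "(\<Sum>(c, E)\<in>Q'. f E) = (\<Sum>(c, E)\<in>Q. f E) + (\<Sum>(c, E)\<in>R \<times> {{\<one>}}. f E) -
          (\<Sum>(c, E)\<in>Q \<inter> R \<times> {{\<one>}}. f E)"
        unfolding Q'_def by (rule sum_Un) (use finQ R in auto)
      moreover have "0 \<le> (\<Sum>(c, E)\<in>Q \<inter> R \<times> {{\<one>}}. f E)"
        by (intro sum_nonneg) (use M in \<open>auto simp: M_def\<close>)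
      ultimately show ?thesis by linarith
    qed
    also have "(\<Sum>(c, E)\<in>R \<times> {{\<one>}}. f E) = real (card R) * M"
      by (simp add: sum.cartesian_product[symmetric] M_def)
    also have "(\<Sum>(c, E)\<in>Q. f E) \<le> (\<Sum>(c, E)\<in>Q. l * real (card E))"
      using QA \<E>(2) by (intro sum_mono) (auto simp: \<C>_def)
    also have "\<dots> = l * (\<Sum>(c, E)\<in>Q. real (card E))"
      by (simp add: sum_distrib_left case_prod_unfold)
    also have "\<dots> \<le> l * (real (card A) / (1 - \<epsilon>))"
      using Q \<epsilon> l by (intro mult_left_mono) (auto simp: quasi_tiles_def field_simps)
    also have "real (card R) * M \<le> \<epsilon> * real (card A) * M"
      using R M by (intro mult_right_mono) auto
    also have "l * (real (card A) / (1 - \<epsilon>)) + \<epsilon> * real (card A) * M = (l / (1 - \<epsilon>) + \<epsilon> * M) * real (card A)"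
      by (simp add: algebra_simps)
    also have "\<dots> \<le> (l + \<delta>) * real (card A)" using small by (intro mult_right_mono) auto
    finally have "(\<Sum>(c, E)\<in>Q'. f E) \<le> (l + \<delta>) * real (card A)" by simp
    moreover have "Q' \<subseteq> A \<times> insert {\<one>} \<E>" "finite Q'" using QA R finQ unfolding Q'_def by auto
    ultimately show ?thesis using eq by blast
  qed
  then have "eventually (\<lambda>i. \<exists>Q\<subseteq>F i \<times> insert {\<one>} \<E>. finite Q \<and> F i = (\<Union>(c, E)\<in>Q. (\<otimes>) c ` E) \<and>
      (\<Sum>(c, E)\<in>Q. f E) \<le> (l + \<delta>) * real (card (F i))) (net_filter I r)"
    by (intro eventually_mono[OF folner_eventually_exits_le[OF net D]]) auto
  moreover have "\<forall>E\<in>insert {\<one>} \<E>. E \<noteq> {} \<and> finite E \<and> E \<subseteq> carrier G"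
    using \<E> by (auto simp: \<C>_def)
  ultimately show ?thesis using \<E>(1) by (intro exI[of _ "insert {\<one>} \<E>"]) auto
qed

text \<open>The Ornstein-Weiss lemma. Shapes on which the quotient nearly attains its lower limit
  tile all sufficiently late Folner sets, so the upper limit does not exceed the lower one. The
  hypothesis on tilings merges subadditivity with the fact that a left translate costs at most as
  much as its shape; cover numbers satisfy it in this form.\<close>

lemma folner_limit_exists:
  assumes net: "right_folner_net G I r F"
    and nonneg: "\<forall>E. E \<noteq> {} \<longrightarrow> finite E \<longrightarrow> E \<subseteq> carrier G \<longrightarrow> 0 \<le> f E"
    and subadd: "\<And>A Q. A \<noteq> {} \<Longrightarrow> A \<subseteq> carrier G \<Longrightarrow> finite Q \<Longrightarrow> A = (\<Union>(c, E)\<in>Q. (\<otimes>) c ` E) \<Longrightarrow>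
      (\<And>c E. (c, E) \<in> Q \<Longrightarrow> c \<in> carrier G \<and> E \<noteq> {} \<and> finite E \<and> E \<subseteq> carrier G) \<Longrightarrow>
      f A \<le> (\<Sum>(c, E)\<in>Q. f E)"
  shows "\<exists>l\<ge>0. ((\<lambda>i. f (F i) / real (card (F i))) \<longlongrightarrow> l) (net_filter I r)"
proof -
  let ?N = "net_filter I r"
  define q where "q = (\<lambda>i. f (F i) / real (card (F i)))"
  have dir: "directed_preorder I r" using net unfolding right_folner_net_def by blast
  note bot = net_filter_neq_bot[OF dir]
  have ev: "eventually (\<lambda>i. F i \<noteq> {} \<and> finite (F i) \<and> F i \<subseteq> carrier G) ?N"
    using eventually_in_net[OF dir] by (rule eventually_mono) (use net in \<open>auto simp: right_folner_net_def\<close>)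
  have q_le: "q i \<le> l \<longleftrightarrow> f (F i) \<le> l * real (card (F i))" if "F i \<noteq> {}" "finite (F i)" for i l
    using that by (simp add: q_def divide_le_eq card_gt_0_iff)
  \<comment> \<open>\<open>Inf L\<close> is the lower limit of \<open>q\<close> along the net:
    levels below it are eventually exceeded.\<close>
  define L where "L = {l. 0 \<le> l \<and> frequently (\<lambda>i. q i \<le> l) ?N}"
  \<comment> \<open>Cutting \<open>F i\<close> into singletons bounds \<open>q\<close> by
    \<open>f {\<one>}\<close>, so \<open>L\<close> is nonempty and the limit is finite.\<close>
  have "f (F i) \<le> f {\<one>} * real (card (F i))" if "F i \<noteq> {}" "finite (F i)" "F i \<subseteq> carrier G" for i
  proof -
    have eq: "F i = (\<Union>(c, E)\<in>F i \<times> {{\<one>}}. (\<otimes>) c ` E)" using that by force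
    have "f (F i) \<le> (\<Sum>(c, E)\<in>F i \<times> {{\<one>}}. f E)"
      by (rule subadd[OF that(1,3) _ eq]) (use that in auto)
    also have "\<dots> = f {\<one>} * real (card (F i))" by (simp add: sum.cartesian_product[symmetric])
    finally show ?thesis .
  qed
  then have "eventually (\<lambda>i. q i \<le> f {\<one>}) ?N"
    by (intro eventually_mono[OF ev]) (use q_le in auto)
  then have "f {\<one>} \<in> L" using nonneg bot by (simp add: L_def eventually_frequently)
  have bdd: "bdd_below L" by (auto simp: L_def bdd_below_def)
  define l where "l = Inf L"
  have l0: "0 \<le> l" unfolding l_def by (rule cInf_greatest) (use \<open>f {\<one>} \<in> L\<close> in \<open>auto simp: L_def\<close>)
  have "(q \<longlongrightarrow> l) ?N"
  proof (rule order_tendstoI)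
    fix a assume a: "a < l"
    show "eventually (\<lambda>i. a < q i) ?N"
    proof (cases "a < 0")
      case True
      have "0 \<le> q i" if "F i \<noteq> {} \<and> finite (F i) \<and> F i \<subseteq> carrier G" for i
        using that nonneg by (simp add: q_def)
      then show ?thesis using True by (intro eventually_mono[OF ev]) (meson less_le_trans)
    next
      case False
      then have "a \<notin> L" using a bdd unfolding l_def by (meson cInf_lower leD)
      then show ?thesis using False by (simp add: L_def not_frequently not_le)
    qed
  next
    fix a assume a: "l < a"
    then obtain b where b: "b \<in> L" "b < a" using cInf_lessD[of L a] \<open>f {\<one>} \<in> L\<close> unfolding l_def by blast
    define \<delta> where "\<delta> = (a - b) / 2"
    have \<delta>: "\<delta> > 0" "b + \<delta> < a" using b by (auto simp: \<delta>_def field_simps)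
    have "frequently (\<lambda>i. f (F i) \<le> b * real (card (F i))) ?N"
    proof -
      have "frequently (\<lambda>i. (F i \<noteq> {} \<and> finite (F i) \<and> F i \<subseteq> carrier G) \<and> q i \<le> b) ?N"
        by (rule frequently_eventually_conj[OF _ ev]) (use b in \<open>simp add: L_def\<close>)
      then show ?thesis by (rule frequently_elim1) (use q_le in auto)
    qed
    from folner_tiling[of I r F f, OF net nonneg this _ \<delta>(1)] b(1) obtain \<E> where
      \<E>: "\<forall>E\<in>\<E>. E \<noteq> {} \<and> finite E \<and> E \<subseteq> carrier G"
      and tile: "eventually (\<lambda>i. \<exists>Q\<subseteq>F i \<times> \<E>. finite Q \<and> F i = (\<Union>(c, E)\<in>Q. (\<otimes>) c ` E) \<and>
      (\<Sum>(c, E)\<in>Q. f E) \<le> (b + \<delta>) * real (card (F i))) ?N"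
      unfolding L_def by auto
    from tile ev show "eventually (\<lambda>i. q i < a) ?N"
    proof eventually_elim
      case (elim i)
      then obtain Q where Q: "Q \<subseteq> F i \<times> \<E>" "finite Q" "F i = (\<Union>(c, E)\<in>Q. (\<otimes>) c ` E)"
        "(\<Sum>(c, E)\<in>Q. f E) \<le> (b + \<delta>) * real (card (F i))" by blast
      have "f (F i) \<le> (\<Sum>(c, E)\<in>Q. f E)"
        by (rule subadd[OF _ _ Q(2,3)]) (use elim(2) Q(1) \<E> in blast)+
      then have "q i \<le> b + \<delta>" using Q(4) elim(2) q_le by auto
      then show ?case using \<delta> by simp
    qed
  qed
  then show ?thesis using l0 unfolding q_def by blast
qed

end

section \<open>Cover numbers\<close>

text \<open>Members of \<open>cover_along X \<sigma> \<U> F\<close> are encoded by choice functions \<open>F \<rightarrow> \<U>\<close>.\<close>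

definition cover_choices ::
    "'a topology \<Rightarrow> ('s \<Rightarrow> 'a \<Rightarrow> 'a) \<Rightarrow> 'a set set \<Rightarrow> 's set \<Rightarrow> ('s \<Rightarrow> 'a set) set \<Rightarrow> bool" where
  "cover_choices X \<sigma> \<U> F \<Phi> \<longleftrightarrow> finite \<Phi> \<and> (\<forall>\<phi>\<in>\<Phi>. \<forall>s\<in>F. \<phi> s \<in> \<U>) \<and>
     (\<forall>x\<in>topspace X. \<exists>\<phi>\<in>\<Phi>. \<forall>s\<in>F. \<sigma> s x \<in> \<phi> s)"

text \<open>Distinct choice functions may cut out the same intersection, so a family of them bounds
  the cover number from above. As \<open>F\<close> is nonempty, these intersections lie inside the
  space.\<close>

lemma cover_number_le_card:
  assumes "F \<noteq> {}" and \<Phi>: "cover_choices X \<sigma> \<U> F \<Phi>"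
  shows "cover_number X (cover_along X \<sigma> \<U> F) \<le> card \<Phi>"
proof -
  define m where "m = (\<lambda>\<phi>. \<Inter>s\<in>F. {x \<in> topspace X. \<sigma> s x \<in> \<phi> s})"
  have "m ` \<Phi> \<subseteq> cover_along X \<sigma> \<U> F"
  proof
    fix W assume "W \<in> m ` \<Phi>"
    then obtain \<phi> where \<phi>: "\<phi> \<in> \<Phi>" "W = m \<phi>" by blast
    then have "\<forall>s\<in>F. {x \<in> topspace X. \<sigma> s x \<in> \<phi> s} \<in> preimage_cover X (\<sigma> s) \<U>"
      using \<Phi> unfolding preimage_cover_def cover_choices_def by blast
    then show "W \<in> cover_along X \<sigma> \<U> F"
      unfolding \<phi>(2) m_def cover_along_def cover_Join_def
      by (intro CollectI exI[of _ "\<lambda>s. {x \<in> topspace X. \<sigma> s x \<in> \<phi> s}"]) simp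
  qed
  moreover have "\<Union>(m ` \<Phi>) = topspace X"
  proof
    show "\<Union>(m ` \<Phi>) \<subseteq> topspace X" using \<open>F \<noteq> {}\<close> by (auto simp: m_def)
    show "topspace X \<subseteq> \<Union>(m ` \<Phi>)" using \<Phi> by (fastforce simp: m_def cover_choices_def)
  qed
  moreover have "finite \<Phi>" using \<Phi> by (simp add: cover_choices_def)
  ultimately have "cover_number X (cover_along X \<sigma> \<U> F) \<le> card (m ` \<Phi>)"
    unfolding cover_number_def by (intro Least_le exI[of _ "m ` \<Phi>"]) auto
  also have "\<dots> \<le> card \<Phi>" using \<open>finite \<Phi>\<close> by (rule card_image_le)
  finally show ?thesis .
qed

text \<open>Compactness yields a finite subcover, without which the \<open>LEAST\<close> in the
  cover number would be unspecified. Each member of a minimal subcover is recorded by one choice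
  function.\<close>

lemma cover_number_attained:
  assumes X: "compact_space X" and \<U>: "open_cover X \<U>" and F: "finite F" "F \<noteq> {}"
    and cont: "\<And>s. s \<in> F \<Longrightarrow> continuous_map X X (\<sigma> s)"
  shows "\<exists>\<Phi>. cover_choices X \<sigma> \<U> F \<Phi> \<and> card \<Phi> \<le> cover_number X (cover_along X \<sigma> \<U> F)"
proof -
  let ?C = "cover_along X \<sigma> \<U> F"
  have pre: "\<exists>\<phi>. (\<forall>s\<in>F. \<phi> s \<in> \<U>) \<and> W = (\<Inter>s\<in>F. {x \<in> topspace X. \<sigma> s x \<in> \<phi> s})" if W: "W \<in> ?C" for W
  proof -
    obtain V where V: "W = (\<Inter>s\<in>F. V s)" "\<forall>s\<in>F. V s \<in> preimage_cover X (\<sigma> s) \<U>"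
      using W unfolding cover_along_def cover_Join_def by blast
    then have "\<forall>s\<in>F. \<exists>U. U \<in> \<U> \<and> V s = {x \<in> topspace X. \<sigma> s x \<in> U}"
      unfolding preimage_cover_def by blast
    then obtain \<phi> where "\<forall>s\<in>F. \<phi> s \<in> \<U> \<and> V s = {x \<in> topspace X. \<sigma> s x \<in> \<phi> s}" by metis
    then show ?thesis using V by (intro exI[of _ \<phi>]) auto
  qed
  have "openin X W" if W: "W \<in> ?C" for W
  proof -
    obtain \<phi> where "(\<forall>s\<in>F. \<phi> s \<in> \<U>) \<and> W = (\<Inter>s\<in>F. {x \<in> topspace X. \<sigma> s x \<in> \<phi> s})"
      using pre[OF W] ..
    then show ?thesis
      using \<U> cont F by (auto intro!: openin_INT2 openin_continuous_map_preimage simp: open_cover_def)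
  qed
  moreover have "topspace X \<subseteq> \<Union>?C"
  proof
    fix x assume x: "x \<in> topspace X"
    have "\<forall>s\<in>F. \<exists>U\<in>\<U>. \<sigma> s x \<in> U"
    proof
      fix s assume "s \<in> F"
      then have "\<sigma> s x \<in> topspace X" using cont x by (auto simp: continuous_map_def)
      then show "\<exists>U\<in>\<U>. \<sigma> s x \<in> U" using \<U> by (auto simp: open_cover_def)
    qed
    then obtain \<phi> where \<phi>: "\<forall>s\<in>F. \<phi> s \<in> \<U> \<and> \<sigma> s x \<in> \<phi> s" by metis
    then have "(\<Inter>s\<in>F. {y \<in> topspace X. \<sigma> s y \<in> \<phi> s}) \<in> ?C"
      unfolding cover_along_def cover_Join_def preimage_cover_def by blast
    then show "x \<in> \<Union>?C" using \<phi> x by blast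
  qed
  ultimately obtain \<V>0 where "finite \<V>0" "\<V>0 \<subseteq> ?C" "topspace X \<subseteq> \<Union>\<V>0"
    using X unfolding compact_space_alt by meson
  moreover have "\<Union>\<V>0 \<subseteq> topspace X" using calculation \<open>\<And>W. W \<in> ?C \<Longrightarrow> openin X W\<close>
    by (meson Sup_least openin_subset subset_iff)
  ultimately have "\<exists>n. \<exists>\<V>\<subseteq>?C. finite \<V> \<and> \<Union>\<V> = topspace X \<and> card \<V> = n" by blast
  from LeastI_ex[OF this] obtain \<V> where \<V>: "\<V> \<subseteq> ?C" "finite \<V>" "\<Union>\<V> = topspace X"
    "card \<V> = cover_number X ?C" unfolding cover_number_def by blast
  have "\<exists>\<phi>. \<forall>s\<in>F. \<phi> s \<in> \<U> \<and> (\<forall>x\<in>W. \<sigma> s x \<in> \<phi> s)" if W: "W \<in> \<V>" for W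
  proof -
    obtain \<phi> where "(\<forall>s\<in>F. \<phi> s \<in> \<U>) \<and> W = (\<Inter>s\<in>F. {x \<in> topspace X. \<sigma> s x \<in> \<phi> s})"
      using pre[OF subsetD[OF \<V>(1) W]] ..
    then show ?thesis by (intro exI[of _ \<phi>]) auto
  qed
  then obtain g where g: "\<And>W s. W \<in> \<V> \<Longrightarrow> s \<in> F \<Longrightarrow> g W s \<in> \<U> \<and> (\<forall>x\<in>W. \<sigma> s x \<in> g W s)"
    by metis
  have "cover_choices X \<sigma> \<U> F (g ` \<V>)"
    unfolding cover_choices_def
  proof (intro conjI ballI)
    fix x assume "x \<in> topspace X"
    then obtain W where W: "W \<in> \<V>" "x \<in> W" using \<V>(3) by blast
    then have "\<forall>s\<in>F. \<sigma> s x \<in> g W s" using g[OF W(1)] by blast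
    then show "\<exists>\<phi>\<in>g ` \<V>. \<forall>s\<in>F. \<sigma> s x \<in> \<phi> s" using W by blast
  qed (use g \<V>(2) in auto)
  moreover have "card (g ` \<V>) \<le> cover_number X ?C" using card_image_le[OF \<V>(2), of g] \<V>(4) by simp
  ultimately show ?thesis by blast
qed

lemma cover_number_pos:
  assumes "compact_space X" "open_cover X \<U>" "finite F" "F \<noteq> {}"
    and "\<And>s. s \<in> F \<Longrightarrow> continuous_map X X (\<sigma> s)" and "topspace X \<noteq> {}"
  shows "0 < cover_number X (cover_along X \<sigma> \<U> F)"
proof -
  obtain \<Phi> where \<Phi>: "cover_choices X \<sigma> \<U> F \<Phi>" "card \<Phi> \<le> cover_number X (cover_along X \<sigma> \<U> F)"
    using cover_number_attained[of X \<U> F \<sigma>] assms by blast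
  then have "\<Phi> \<noteq> {}" "finite \<Phi>" using assms(6) by (auto simp: cover_choices_def)
  then have "0 < card \<Phi>" by (simp add: card_gt_0_iff)
  then show ?thesis using \<Phi>(2) by linarith
qed

text \<open>In a right action the orbit of \<open>x\<close> along a tile cE is the orbit along
  \<open>E\<close> of the image of \<open>x\<close> under \<open>\<sigma> c\<close>. A cover along
  \<open>E\<close> therefore serves every tile of shape \<open>E\<close>, and independent choices
  for all tiles give the product.\<close>

lemma cover_number_tiling:
  assumes S: "monoid S" and act: "right_action S X \<sigma>" and X: "compact_space X" and \<U>: "open_cover X \<U>"
    and A: "A \<noteq> {}" "A \<subseteq> carrier S" and Q: "finite Q" "A = (\<Union>(c, E)\<in>Q. (\<otimes>\<^bsub>S\<^esub>) c ` E)"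
    and tiles: "\<And>c E. (c, E) \<in> Q \<Longrightarrow> c \<in> carrier S \<and> E \<noteq> {} \<and> finite E \<and> E \<subseteq> carrier S"
  shows "cover_number X (cover_along X \<sigma> \<U> A) \<le> (\<Prod>(c, E)\<in>Q. cover_number X (cover_along X \<sigma> \<U> E))"
proof -
  interpret monoid S by fact
  have cont: "\<And>s. s \<in> carrier S \<Longrightarrow> continuous_map X X (\<sigma> s)"
    using act unfolding right_action_def by blast
  have "\<forall>q\<in>Q. \<exists>\<Phi>. cover_choices X \<sigma> \<U> (snd q) \<Phi> \<and>
      card \<Phi> \<le> cover_number X (cover_along X \<sigma> \<U> (snd q))"
    by (intro ballI cover_number_attained[OF X \<U>]) (use tiles cont in force)+
  then obtain \<Phi> where \<Phi>: "\<And>q. q \<in> Q \<Longrightarrow> cover_choices X \<sigma> \<U> (snd q) (\<Phi> q)"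
    "\<And>q. q \<in> Q \<Longrightarrow> card (\<Phi> q) \<le> cover_number X (cover_along X \<sigma> \<U> (snd q))" by metis
  \<comment> \<open>Tiles may overlap: each \<open>s\<close> is read off from one tile
    \<open>t s\<close> fixed in advance, at the position \<open>e s\<close> in its shape.\<close>
  have "\<forall>s\<in>A. \<exists>q e. q \<in> Q \<and> e \<in> snd q \<and> s = fst q \<otimes>\<^bsub>S\<^esub> e" using Q(2) by fastforce
  then obtain t e where t: "\<And>s. s \<in> A \<Longrightarrow> t s \<in> Q \<and> e s \<in> snd (t s) \<and> s = fst (t s) \<otimes>\<^bsub>S\<^esub> e s" by metis
  define P where "P = (\<Pi>\<^sub>E q\<in>Q. \<Phi> q)"
  define m where "m = (\<lambda>\<psi> s. \<psi> (t s) (e s) :: 'c set)"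
  have finP: "finite P" unfolding P_def
    using Q \<Phi>(1) by (intro finite_PiE) (auto simp: cover_choices_def)
  have "cover_choices X \<sigma> \<U> A (m ` P)"
    unfolding cover_choices_def
  proof (intro conjI ballI)
    show "finite (m ` P)" using finP by simp
  next
    fix \<phi> s assume "\<phi> \<in> m ` P" and s: "s \<in> A"
    then obtain \<psi> where \<psi>: "\<psi> \<in> P" "\<phi> = m \<psi>" by blast
    have "\<psi> (t s) \<in> \<Phi> (t s)" using \<psi>(1) t[OF s] by (auto simp: P_def PiE_def)
    then show "\<phi> s \<in> \<U>" using \<Phi>(1)[of "t s"] t[OF s] unfolding \<psi>(2) m_def cover_choices_def by blast
  next
    fix x assume x: "x \<in> topspace X"
    have "\<forall>q\<in>Q. \<exists>\<phi>\<in>\<Phi> q. \<forall>s\<in>snd q. \<sigma> s (\<sigma> (fst q) x) \<in> \<phi> s"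
    proof
      fix q assume q: "q \<in> Q"
      then have "fst q \<in> carrier S" using tiles[of "fst q" "snd q"] by simp
      then have "\<sigma> (fst q) x \<in> topspace X" using cont x by (auto simp: continuous_map_def)
      then show "\<exists>\<phi>\<in>\<Phi> q. \<forall>s\<in>snd q. \<sigma> s (\<sigma> (fst q) x) \<in> \<phi> s"
        using \<Phi>(1)[OF q] unfolding cover_choices_def by blast
    qed
    then obtain \<psi> where \<psi>: "\<And>q. q \<in> Q \<Longrightarrow> \<psi> q \<in> \<Phi> q \<and> (\<forall>s\<in>snd q. \<sigma> s (\<sigma> (fst q) x) \<in> \<psi> q s)"
      by metis
    have "\<sigma> s x \<in> m (restrict \<psi> Q) s" if s: "s \<in> A" for s
    proof -
      have ts: "t s \<in> Q" "e s \<in> snd (t s)" "s = fst (t s) \<otimes>\<^bsub>S\<^esub> e s" using t[OF s] by auto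
      have "fst (t s) \<in> carrier S" "e s \<in> carrier S" using tiles[of "fst (t s)" "snd (t s)"] ts by auto
      then have "\<sigma> (fst (t s) \<otimes>\<^bsub>S\<^esub> e s) x = \<sigma> (e s) (\<sigma> (fst (t s)) x)"
        using act x unfolding right_action_def by blast
      then show ?thesis using \<psi>[OF ts(1)] ts by (simp add: m_def)
    qed
    moreover have "restrict \<psi> Q \<in> P" using \<psi> by (auto simp: P_def)
    ultimately show "\<exists>\<phi>\<in>m ` P. \<forall>s\<in>A. \<sigma> s x \<in> \<phi> s" by blast
  qed
  then have "cover_number X (cover_along X \<sigma> \<U> A) \<le> card (m ` P)"
    by (rule cover_number_le_card[OF A(1)])
  also have "\<dots> \<le> card P" using finP by (rule card_image_le)
  also have "\<dots> = (\<Prod>q\<in>Q. card (\<Phi> q))" unfolding P_def using Q by (simp add: card_PiE)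
  also have "\<dots> \<le> (\<Prod>q\<in>Q. cover_number X (cover_along X \<sigma> \<U> (snd q)))"
    by (intro prod_mono) (use \<Phi> in auto)
  finally show ?thesis by (simp add: case_prod_unfold)
qed

abbreviation log_cover_number ::
    "'a topology \<Rightarrow> ('s \<Rightarrow> 'a \<Rightarrow> 'a) \<Rightarrow> 'a set set \<Rightarrow> 's set \<Rightarrow> real" where
  "log_cover_number X \<sigma> \<U> A \<equiv> ln (real (cover_number X (cover_along X \<sigma> \<U> A)))"

text \<open>\<open>H_top\<close> is a \<open>Lim\<close>, which carries information only once
  convergence is known; the Ornstein-Weiss lemma supplies it for the logarithm of the cover number.
  Nonnegativity is recorded for the suprema taken at the end.\<close>

lemma H_top_tendsto:
  assumes "monoid_cancel S" and net: "right_folner_net S I r F" and act: "right_action S X \<sigma>"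
    and X: "compact_space X" "topspace X \<noteq> {}" and \<U>: "open_cover X \<U>"
  shows "((\<lambda>i. log_cover_number X \<sigma> \<U> (F i) / real (card (F i))) \<longlongrightarrow> H_top I r F X \<sigma> \<U>) (net_filter I r)"
    and "0 \<le> H_top I r F X \<sigma> \<U>"
proof -
  interpret monoid_cancel S by fact
  have cont: "\<And>s. s \<in> carrier S \<Longrightarrow> continuous_map X X (\<sigma> s)"
    using act unfolding right_action_def by blast
  have pos: "0 < cover_number X (cover_along X \<sigma> \<U> E)"
    if "E \<noteq> {}" "finite E" "E \<subseteq> carrier S" for E
    by (rule cover_number_pos) (use that X \<U> cont in auto)
  have "\<exists>l\<ge>0. ((\<lambda>i. log_cover_number X \<sigma> \<U> (F i) / real (card (F i))) \<longlongrightarrow> l) (net_filter I r)"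
  proof (rule folner_limit_exists[OF net, where f = "log_cover_number X \<sigma> \<U>"])
    show "\<forall>E. E \<noteq> {} \<longrightarrow> finite E \<longrightarrow> E \<subseteq> carrier S \<longrightarrow> 0 \<le> log_cover_number X \<sigma> \<U> E"
      using pos by (simp add: Suc_le_eq)
  next
    fix A Q assume A: "A \<noteq> {}" "A \<subseteq> carrier S" and Q: "finite Q" "A = (\<Union>(c, E)\<in>Q. (\<otimes>\<^bsub>S\<^esub>) c ` E)"
      and tiles: "\<And>c E. (c, E) \<in> Q \<Longrightarrow> c \<in> carrier S \<and> E \<noteq> {} \<and> finite E \<and> E \<subseteq> carrier S"
    have "finite A" unfolding Q(2) using Q(1) tiles by auto
    have "cover_number X (cover_along X \<sigma> \<U> A) \<le> (\<Prod>(c, E)\<in>Q. cover_number X (cover_along X \<sigma> \<U> E))"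
      by (rule cover_number_tiling[OF _ act X(1) \<U> A Q tiles]) (rule monoid_axioms)
    then have "real (cover_number X (cover_along X \<sigma> \<U> A)) \<le>
        real (\<Prod>q\<in>Q. cover_number X (cover_along X \<sigma> \<U> (snd q)))"
      unfolding of_nat_le_iff by (simp add: case_prod_unfold)
    then have "log_cover_number X \<sigma> \<U> A \<le> ln (\<Prod>q\<in>Q. real (cover_number X (cover_along X \<sigma> \<U> (snd q))))"
      using pos[OF A(1) \<open>finite A\<close> A(2)] by (simp add: ln_mono)
    also have "\<dots> = (\<Sum>q\<in>Q. log_cover_number X \<sigma> \<U> (snd q))"
    proof (rule ln_prod[OF Q(1)])
      fix q assume "q \<in> Q"
      then show "real (cover_number X (cover_along X \<sigma> \<U> (snd q))) \<noteq> 0"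
        using pos[of "snd q"] tiles[of "fst q" "snd q"] by simp
    qed
    finally show "log_cover_number X \<sigma> \<U> A \<le> (\<Sum>(c, E)\<in>Q. log_cover_number X \<sigma> \<U> E)"
      unfolding case_prod_unfold .
  qed
  then obtain l where l: "l \<ge> 0"
    "((\<lambda>i. log_cover_number X \<sigma> \<U> (F i) / real (card (F i))) \<longlongrightarrow> l) (net_filter I r)" by blast
  have "directed_preorder I r" using net unfolding right_folner_net_def by blast
  then have "H_top I r F X \<sigma> \<U> = l"
    unfolding H_top_def by (intro tendsto_Lim net_filter_neq_bot l)
  then show "((\<lambda>i. log_cover_number X \<sigma> \<U> (F i) / real (card (F i))) \<longlongrightarrow> H_top I r F X \<sigma> \<U>) (net_filter I r)"
    "0 \<le> H_top I r F X \<sigma> \<U>" using l by auto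
qed

section \<open>Compact groups and their coset spaces\<close>

lemma (in group) inv_mult_cancel_l [simp]:
  "x \<in> carrier G \<Longrightarrow> y \<in> carrier G \<Longrightarrow> inv x \<otimes> (x \<otimes> y) = y"
  by (simp flip: m_assoc)

lemma (in group) mult_inv_cancel_l [simp]:
  "x \<in> carrier G \<Longrightarrow> y \<in> carrier G \<Longrightarrow> x \<otimes> (inv x \<otimes> y) = y"
  by (simp flip: m_assoc)

context compact_group
begin

lemma continuous_map_mult:
  assumes "continuous_map Y T f" "continuous_map Y T g"
  shows "continuous_map Y T (\<lambda>y. f y \<otimes> g y)"
proof -
  have "continuous_map Y (prod_topology T T) (\<lambda>y. (f y, g y))"
    using assms by (simp add: continuous_map_pairwise o_def)
  from continuous_map_compose[OF this continuous_mult] show ?thesis by (simp add: o_def)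
qed

lemma continuous_map_inv:
  assumes "continuous_map Y T f"
  shows "continuous_map Y T (\<lambda>y. inv (f y))"
  using continuous_map_compose[OF assms continuous_inv] by (simp add: o_def)

lemma openin_l_translate:
  assumes "openin T W" "x \<in> carrier G"
  shows "openin T {y \<in> carrier G. x \<otimes> y \<in> W}"
proof -
  have "continuous_map T T (\<lambda>y. x \<otimes> y)"
    by (rule continuous_map_mult) (use assms topspace_eq in auto)
  then show ?thesis using openin_continuous_map_preimage[of T T "\<lambda>y. x \<otimes> y" W] assms topspace_eq by simp
qed

lemma compactin_closed:
  assumes "closedin T L"
  shows "compactin T L"
  using compact assms by (simp add: closedin_compact_space)

text \<open>Take W = LVL. For w, w' in W the quotient w^-1 w' has the form m^-1 v^-1 (l^-1 l') v'
  m', so the neighbourhood \<open>V\<close> of \<one> must keep l v^-1 m w n inside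
  \<open>O'\<close> for all l, m, n in \<open>L\<close> at once. At v = w = \<one> this product lies
  in \<open>L\<close>, and compactness of \<open>L \<times> L \<times> L\<close> yields such a
  \<open>V\<close>. Invariance on both sides turns x^-1 y \<in> W into a relation between cosets of
  \<open>L\<close>; for trivial \<open>L\<close> this is the usual symmetric neighbourhood of half
  size.\<close>

lemma ex_biinvariant_nbhd:
  assumes L: "subgroup L G" "closedin T L" and O: "openin T O'" "L \<subseteq> O'"
  shows "\<exists>W. openin T W \<and> L \<subseteq> W \<and> W \<subseteq> O' \<and> (\<forall>w\<in>W. inv w \<in> W) \<and>
    (\<forall>l\<in>L. \<forall>w\<in>W. l \<otimes> w \<in> W \<and> w \<otimes> l \<in> W) \<and> (\<forall>w\<in>W. \<forall>w'\<in>W. inv w \<otimes> w' \<in> O')"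
proof -
  interpret L: subgroup L G by fact
  define f where "f = (\<lambda>((l, m, n), (v, w)). l \<otimes> inv v \<otimes> m \<otimes> w \<otimes> n)"
  let ?P = "prod_topology T (prod_topology T T)" and ?Q = "prod_topology T T"
  have cont: "continuous_map (prod_topology ?P ?Q) T f"
    unfolding f_def case_prod_unfold
    by (intro continuous_map_mult continuous_map_inv continuous_map_fst continuous_map_snd
        continuous_map_compose[OF continuous_map_fst, unfolded o_def]
        continuous_map_compose[OF continuous_map_snd, unfolded o_def])
  have top: "topspace (prod_topology ?P ?Q) = (carrier G \<times> carrier G \<times> carrier G) \<times> carrier G \<times> carrier G"
    using topspace_eq by simp
  define Z where "Z = {z \<in> topspace (prod_topology ?P ?Q). f z \<in> O'}"
  have "openin (prod_topology ?P ?Q) Z"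
    unfolding Z_def by (rule openin_continuous_map_preimage[OF cont O(1)])
  moreover have "(L \<times> L \<times> L) \<times> {(\<one>, \<one>)} \<subseteq> Z"
    using O(2) unfolding Z_def top f_def by (auto simp: subset_iff)
  moreover have "compactin ?P (L \<times> L \<times> L)"
    using compactin_closed[OF L(2)] by (simp add: compactin_Times)
  moreover have "compactin ?Q {(\<one>, \<one>)}" using topspace_eq by simp
  ultimately obtain A B where AB: "openin ?Q B" "L \<times> L \<times> L \<subseteq> A" "{(\<one>, \<one>)} \<subseteq> B" "A \<times> B \<subseteq> Z"
    using Wallace_theorem_prod_topology[of ?P "L \<times> L \<times> L" ?Q "{(\<one>, \<one>)}" Z] by metis
  have "(\<one>, \<one>) \<in> B" using AB(3) by simp
  from AB(1)[unfolded openin_prod_topology_alt, rule_format, OF this]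
  obtain V1 V2 where V: "openin T V1" "openin T V2" "\<one> \<in> V1" "\<one> \<in> V2" "V1 \<times> V2 \<subseteq> B"
    by auto
  \<comment> \<open>Closing \<open>V\<close> under inverses makes LVL closed under inverses.\<close>
  define V where "V = V1 \<inter> V2 \<inter> {x \<in> carrier G. inv x \<in> V1 \<inter> V2}"
  have VG: "V \<subseteq> carrier G" and V1: "\<one> \<in> V" and Vinv: "\<And>v. v \<in> V \<Longrightarrow> inv v \<in> V"
    using V unfolding V_def by auto
  have "openin T {x \<in> carrier G. inv x \<in> V1 \<inter> V2}"
    using openin_continuous_map_preimage[OF continuous_inv, of "V1 \<inter> V2"] V topspace_eq by auto
  then have V_open: "openin T V" unfolding V_def using V by (intro openin_Int)
  have VO: "l \<otimes> inv v \<otimes> m \<otimes> w \<otimes> n \<in> O'" if "l \<in> L" "m \<in> L" "n \<in> L" "v \<in> V" "w \<in> V" for l m n v w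
  proof -
    have "((l, m, n), (v, w)) \<in> A \<times> B" using that AB(2) V(5) unfolding V_def by auto
    then have "((l, m, n), (v, w)) \<in> Z" using AB(4) by blast
    then show ?thesis unfolding Z_def f_def by simp
  qed
  define W where "W = {l \<otimes> v \<otimes> m | l v m. l \<in> L \<and> v \<in> V \<and> m \<in> L}"
  have W_I: "l \<otimes> v \<otimes> m \<in> W" if "l \<in> L" "v \<in> V" "m \<in> L" for l v m
    using that unfolding W_def by blast
  have W_E: thesis
    if "w \<in> W" "\<And>l v m. w = l \<otimes> v \<otimes> m \<Longrightarrow> l \<in> L \<Longrightarrow> v \<in> V \<Longrightarrow> m \<in> L \<Longrightarrow> thesis" for w thesis
    using that unfolding W_def by (elim CollectE exE conjE)
  have LG: "L \<subseteq> carrier G" by (rule L.subset)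
  have "W = (\<Union>l\<in>L. \<Union>m\<in>L. {x \<in> carrier G. inv l \<otimes> x \<otimes> inv m \<in> V})" (is "_ = ?U")
  proof
    show "W \<subseteq> ?U"
    proof
      fix x assume "x \<in> W"
      then obtain l v m where x: "l \<in> L" "v \<in> V" "m \<in> L" "x = l \<otimes> v \<otimes> m" unfolding W_def by blast
      then have G: "l \<in> carrier G" "v \<in> carrier G" "m \<in> carrier G" using LG VG by auto
      then have "x \<in> carrier G" "inv l \<otimes> x \<otimes> inv m = v" using x(4) by (simp_all add: m_assoc)
      then show "x \<in> ?U" using x(1-3) by blast
    qed
    show "?U \<subseteq> W"
    proof
      fix x assume "x \<in> ?U"
      then obtain l m where x: "l \<in> L" "m \<in> L" "x \<in> carrier G" "inv l \<otimes> x \<otimes> inv m \<in> V" by blast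
      then have G: "l \<in> carrier G" "m \<in> carrier G" using LG by auto
      have "l \<otimes> (inv l \<otimes> x \<otimes> inv m) \<otimes> m \<in> W" using x W_I by blast
      then show "x \<in> W" using G x(3) by (simp add: m_assoc)
    qed
  qed
  moreover have "openin T {x \<in> carrier G. inv l \<otimes> x \<otimes> inv m \<in> V}" if "l \<in> L" "m \<in> L" for l m
  proof -
    have "continuous_map T T (\<lambda>x. inv l \<otimes> x \<otimes> inv m)"
      by (intro continuous_map_mult) (use that LG topspace_eq in auto)
    from openin_continuous_map_preimage[OF this V_open] show ?thesis using topspace_eq by simp
  qed
  ultimately have W_open: "openin T W" by auto
  have LW: "L \<subseteq> W"
  proof
    fix l assume l: "l \<in> L"
    have "l \<otimes> \<one> \<otimes> \<one> \<in> W" using l V1 by (intro W_I) auto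
    then show "l \<in> W" using l LG by (simp add: subset_iff)
  qed
  have WW: "inv w \<otimes> w' \<in> O'" if ww: "w \<in> W" "w' \<in> W" for w w'
  proof -
    obtain l v m where w: "w = l \<otimes> v \<otimes> m" "l \<in> L" "v \<in> V" "m \<in> L" using ww(1) by (rule W_E)
    obtain l' v' m' where w': "w' = l' \<otimes> v' \<otimes> m'" "l' \<in> L" "v' \<in> V" "m' \<in> L" using ww(2) by (rule W_E)
    have G: "l \<in> carrier G" "v \<in> carrier G" "m \<in> carrier G" "l' \<in> carrier G" "v' \<in> carrier G" "m' \<in> carrier G"
      using w w' LG VG by auto
    have "inv w \<otimes> w' = inv m \<otimes> inv v \<otimes> (inv l \<otimes> l') \<otimes> v' \<otimes> m'"
      using G unfolding w(1) w'(1) by (simp add: inv_mult_group m_assoc)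
    also have "\<dots> \<in> O'" using w w' by (intro VO) auto
    finally show ?thesis .
  qed
  have W_inv: "inv w \<in> W" if ww: "w \<in> W" for w
  proof -
    obtain l v m where w: "w = l \<otimes> v \<otimes> m" "l \<in> L" "v \<in> V" "m \<in> L" using ww by (rule W_E)
    then have "inv w = inv m \<otimes> inv v \<otimes> inv l"
      using LG VG by (simp add: inv_mult_group m_assoc subset_iff)
    moreover have "inv m \<otimes> inv v \<otimes> inv l \<in> W" using w Vinv by (intro W_I) auto
    ultimately show ?thesis by simp
  qed
  have W_mult: "k \<otimes> w \<in> W" "w \<otimes> k \<in> W" if k: "k \<in> L" and ww: "w \<in> W" for k w
  proof -
    obtain l v m where w: "w = l \<otimes> v \<otimes> m" "l \<in> L" "v \<in> V" "m \<in> L" using ww by (rule W_E)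
    then have "k \<otimes> w = (k \<otimes> l) \<otimes> v \<otimes> m" "w \<otimes> k = l \<otimes> v \<otimes> (m \<otimes> k)"
      using k LG VG by (simp_all add: m_assoc subset_iff)
    moreover have "(k \<otimes> l) \<otimes> v \<otimes> m \<in> W" "l \<otimes> v \<otimes> (m \<otimes> k) \<in> W"
      using w k by (auto intro!: W_I)
    ultimately show "k \<otimes> w \<in> W" "w \<otimes> k \<in> W" by (simp_all only:)
  qed
  have "W \<subseteq> O'"
  proof
    fix w assume w: "w \<in> W"
    then have "w \<in> carrier G" using openin_subset[OF W_open] topspace_eq by auto
    then show "w \<in> O'" using WW[of \<one> w] w subsetD[OF LW L.one_closed] by simp
  qed
  then show ?thesis using W_open LW W_inv W_mult WW by (intro exI[of _ W] conjI ballI)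
qed

end

section \<open>Actions by endomorphisms, Bowen neighbourhoods and separated sets\<close>

locale compact_group_action = compact_group G T + S: monoid S
  for G :: "('k, 'n) monoid_scheme" (structure) and T :: "'k topology"
    and S :: "('s, 'm) monoid_scheme" +
  fixes \<rho> :: "'s \<Rightarrow> 'k \<Rightarrow> 'k"
  assumes group_action: "right_group_action S G T \<rho>"
begin

lemma rho_hom: "s \<in> carrier S \<Longrightarrow> \<rho> s \<in> hom G G"
  using group_action unfolding right_group_action_def by blast

lemma rho_closed [simp]: "s \<in> carrier S \<Longrightarrow> x \<in> carrier G \<Longrightarrow> \<rho> s x \<in> carrier G"
  using rho_hom hom_in_carrier by metis

lemma rho_mult [simp]:
  "s \<in> carrier S \<Longrightarrow> x \<in> carrier G \<Longrightarrow> y \<in> carrier G \<Longrightarrow> \<rho> s (x \<otimes> y) = \<rho> s x \<otimes> \<rho> s y"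
  using rho_hom hom_mult by metis

lemma rho_one [simp]: "s \<in> carrier S \<Longrightarrow> \<rho> s \<one> = \<one>"
  using rho_hom hom_one is_group by metis

lemma rho_inv [simp]: "s \<in> carrier S \<Longrightarrow> x \<in> carrier G \<Longrightarrow> \<rho> s (inv x) = inv (\<rho> s x)"
  using rho_hom group_hom.hom_inv[of G G] by (simp add: group_hom_def group_hom_axioms_def is_group)

lemma rho_comp:
  "s \<in> carrier S \<Longrightarrow> t \<in> carrier S \<Longrightarrow> x \<in> carrier G \<Longrightarrow> \<rho> (s \<otimes>\<^bsub>S\<^esub> t) x = \<rho> t (\<rho> s x)"
  using group_action topspace_eq unfolding right_group_action_def right_action_def by blast

lemma continuous_rho: "s \<in> carrier S \<Longrightarrow> continuous_map T T (\<rho> s)"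
  using group_action unfolding right_group_action_def right_action_def by blast

text \<open>As each \<open>\<rho> s\<close> is an endomorphism, the Bowen ball of order
  \<open>F\<close> and size \<open>W\<close> around \<open>x\<close> is the left translate of this
  set by \<open>x\<close>, so a single set describes the balls around all points.\<close>

definition bowen :: "'s set \<Rightarrow> 'k set \<Rightarrow> 'k set" where
  "bowen F W = {x \<in> carrier G. \<forall>s\<in>F. \<rho> s x \<in> W}"

lemma openin_bowen:
  assumes "finite F" "F \<subseteq> carrier S" "openin T W"
  shows "openin T (bowen F W)"
proof (cases "F = {}")
  case True
  then show ?thesis using topspace_eq by (simp add: bowen_def flip: topspace_eq)
next
  case False
  have "openin T {x \<in> carrier G. \<rho> s x \<in> W}" if "s \<in> F" for s
    using openin_continuous_map_preimage[OF continuous_rho assms(3)] that assms(2) topspace_eq by auto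
  moreover have "bowen F W = (\<Inter>s\<in>F. {x \<in> carrier G. \<rho> s x \<in> W})"
    using False by (auto simp: bowen_def)
  ultimately show ?thesis using False assms(1) by (auto intro!: openin_INT2)
qed

lemma one_in_bowen: "F \<subseteq> carrier S \<Longrightarrow> \<one> \<in> W \<Longrightarrow> \<one> \<in> bowen F W"
  by (auto simp: bowen_def subset_iff)

lemma bowen_inv:
  assumes "F \<subseteq> carrier S" "\<forall>w\<in>W. inv w \<in> W" "x \<in> bowen F W"
  shows "inv x \<in> bowen F W"
  using assms by (auto simp: bowen_def subset_iff)

text \<open>If \<open>F \<subseteq> carrier S\<close> and \<open>W\<close> contains an invariant
  subgroup, two distinct points of one left coset of it are never separated. A separated set then
  has at most one point per coset, so the same notion serves K, H and K/H.\<close>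

definition separated :: "'s set \<Rightarrow> 'k set \<Rightarrow> 'k set \<Rightarrow> bool" where
  "separated F W B \<longleftrightarrow> (\<forall>x\<in>B. \<forall>y\<in>B. x \<noteq> y \<longrightarrow> inv x \<otimes> y \<notin> bowen F W)"

end

text \<open>The space \<open>X\<close> is the coset space \<open>A / L\<close> of invariant closed subgroups \<open>L \<subseteq> A\<close>, presented
  by a quotient map \<open>p\<close>. The three instances are \<open>K / {1}\<close>, \<open>H / {1}\<close> and \<open>K / H\<close>.\<close>

locale coset_space_action = compact_group_action G T S \<rho>
  for G :: "('k, 'n) monoid_scheme" (structure) and T :: "'k topology"
    and S :: "('s, 'm) monoid_scheme" and \<rho> :: "'s \<Rightarrow> 'k \<Rightarrow> 'k" +
  fixes A L :: "'k set" and X :: "'x topology" and p :: "'k \<Rightarrow> 'x" and \<sigma> :: "'s \<Rightarrow> 'x \<Rightarrow> 'x"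
  assumes A: "subgroup A G" "closedin T A" and L: "subgroup L G" "closedin T L" "L \<subseteq> A"
    and A_invariant: "invariant_under S \<rho> A"
    and quotient: "quotient_map (subtopology T A) X p"
    and p_eq_iff: "\<And>x y. x \<in> A \<Longrightarrow> y \<in> A \<Longrightarrow> p x = p y \<longleftrightarrow> inv x \<otimes> y \<in> L"
    and sigma: "\<And>s x. s \<in> carrier S \<Longrightarrow> x \<in> A \<Longrightarrow> \<sigma> s (p x) = p (\<rho> s x)"
begin

lemma A_sub: "A \<subseteq> carrier G" using A(1) by (rule subgroup.subset)

lemma rho_A: "s \<in> carrier S \<Longrightarrow> x \<in> A \<Longrightarrow> \<rho> s x \<in> A"
  using A_invariant unfolding invariant_under_def by blast

lemma topspace_A: "topspace (subtopology T A) = A"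
  using A_sub topspace_eq by auto

lemma topspace_X: "topspace X = p ` A"
  using quotient_imp_surjective_map[OF quotient] topspace_A by simp

lemma openin_X_iff: "openin X U \<longleftrightarrow> U \<subseteq> p ` A \<and> openin (subtopology T A) {a \<in> A. p a \<in> U}"
proof -
  have "U \<subseteq> p ` A \<longrightarrow> openin (subtopology T A) {a \<in> A. p a \<in> U} = openin X U"
    using quotient unfolding quotient_map_def topspace_A topspace_X by blast
  moreover have "openin X U \<Longrightarrow> U \<subseteq> p ` A" using openin_subset topspace_X by metis
  ultimately show ?thesis by blast
qed

lemma compact_A: "compact_space (subtopology T A)"
  using compactin_closed[OF A(2)] by (simp add: compact_space_subtopology)

lemma compact_X: "compact_space X"
  using compact_A image_compactin[OF _ quotient_imp_continuous_map[OF quotient], of A]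
  unfolding compact_space_def topspace_A topspace_X by blast

lemma right_action_X: "right_action S X \<sigma>"
  unfolding right_action_def
proof (intro conjI ballI)
  fix s assume s: "s \<in> carrier S"
  have "continuous_map (subtopology T A) (subtopology T A) (\<rho> s)"
    by (intro continuous_map_into_subtopology continuous_map_from_subtopology continuous_rho[OF s])
      (use rho_A[OF s] in \<open>auto simp only: topspace_A\<close>)
  then have "continuous_map (subtopology T A) X (p \<circ> \<rho> s)"
    using quotient quotient_imp_continuous_map continuous_map_compose by blast
  then have "continuous_map (subtopology T A) X (\<sigma> s \<circ> p)"
    by (rule continuous_map_eq) (use sigma s topspace_A in simp)
  then show "continuous_map X X (\<sigma> s)"
    using continuous_compose_quotient_map[OF quotient] by blast
next
  fix x assume "x \<in> topspace X"
  then obtain a where a: "a \<in> A" "x = p a" using topspace_X by auto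
  moreover have "\<rho> \<one>\<^bsub>S\<^esub> a = a"
    using a(1) A_sub group_action topspace_eq unfolding right_group_action_def right_action_def by blast
  ultimately show "\<sigma> \<one>\<^bsub>S\<^esub> x = x" by (simp add: sigma)
next
  fix s t x assume st: "s \<in> carrier S" "t \<in> carrier S" and "x \<in> topspace X"
  then obtain a where a: "a \<in> A" "x = p a" using topspace_X by auto
  then have "a \<in> carrier G" using A_sub by auto
  then show "\<sigma> (s \<otimes>\<^bsub>S\<^esub> t) x = \<sigma> t (\<sigma> s x)"
    using a st by (simp add: sigma rho_A rho_comp)
qed

lemma continuous_sigma: "s \<in> carrier S \<Longrightarrow> continuous_map X X (\<sigma> s)"
  using right_action_X unfolding right_action_def by blast

lemma topspace_X_nonempty: "topspace X \<noteq> {}"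
  using topspace_X subgroup.one_closed[OF A(1)] by auto

text \<open>The Lebesgue number lemma with a neighbourhood of \<open>L\<close> in place of a radius.
  As \<open>p\<close> is constant on xL, multiplication maps {x} \<times> L into the preimage of one
  member. Compactness of \<open>L\<close> extends this to a product of neighbourhoods of x and of
  \<open>L\<close>; compactness of \<open>A\<close> leaves finitely many x, and the neighbourhoods
  of \<open>L\<close> are intersected. The condition \<open>x \<otimes> w \<in> A\<close> appears
  because \<open>W\<close> is a neighbourhood in the whole group.\<close>

lemma lebesgue_nbhd:
  assumes \<U>: "open_cover X \<U>"
  shows "\<exists>W. openin T W \<and> L \<subseteq> W \<and> (\<forall>w\<in>W. inv w \<in> W) \<and> (\<forall>l\<in>L. \<forall>w\<in>W. l \<otimes> w \<in> W \<and> w \<otimes> l \<in> W) \<and>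
    (\<forall>x\<in>A. \<exists>U\<in>\<U>. \<forall>w\<in>W. x \<otimes> w \<in> A \<longrightarrow> p (x \<otimes> w) \<in> U)"
proof -
  let ?TA = "subtopology T A"
  interpret A: subgroup A G by (rule A(1))
  have contm: "continuous_map (prod_topology ?TA ?TA) ?TA (\<lambda>z. fst z \<otimes> snd z)"
  proof (rule continuous_map_into_subtopology)
    have "continuous_map ?TA T (\<lambda>x. x)" by (rule continuous_map_from_subtopology) simp
    then have "continuous_map (prod_topology ?TA ?TA) T (\<lambda>z. fst z)"
      "continuous_map (prod_topology ?TA ?TA) T (\<lambda>z. snd z)"
      using continuous_map_compose[OF continuous_map_fst, of ?TA T "\<lambda>x. x"]
        continuous_map_compose[OF continuous_map_snd, of ?TA T "\<lambda>x. x"] by (simp_all add: o_def)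
    then show "continuous_map (prod_topology ?TA ?TA) T (\<lambda>z. fst z \<otimes> snd z)"
      by (rule continuous_map_mult)
    show "(\<lambda>z. fst z \<otimes> snd z) \<in> topspace (prod_topology ?TA ?TA) \<rightarrow> A"
      unfolding topspace_prod_topology topspace_A by (rule Pi_I) (simp add: mem_Times_iff)
  qed
  have LA: "compactin ?TA L"
    using compactin_closed[OF L(2)] L(3) by (simp add: compactin_subtopology)
  have "\<exists>Y V U. openin ?TA Y \<and> openin ?TA V \<and> x \<in> Y \<and> L \<subseteq> V \<and> U \<in> \<U> \<and> (\<forall>y\<in>Y. \<forall>v\<in>V. p (y \<otimes> v) \<in> U)"
    if x: "x \<in> A" for x
  proof -
    have "p x \<in> \<Union>\<U>" and opens: "\<forall>U\<in>\<U>. openin X U"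
      using \<U> x topspace_X unfolding open_cover_def by auto
    then obtain U where U: "U \<in> \<U>" "p x \<in> U" by (elim UnionE)
    have "openin X U" using opens U(1) by (rule bspec)
    then have "openin ?TA {a \<in> A. p a \<in> U}" using openin_X_iff by blast
    from openin_continuous_map_preimage[OF contm this]
    have op: "openin (prod_topology ?TA ?TA) {z \<in> A \<times> A. fst z \<otimes> snd z \<in> {a \<in> A. p a \<in> U}}"
      unfolding topspace_prod_topology topspace_A .
    have sub: "{x} \<times> L \<subseteq> {z \<in> A \<times> A. fst z \<otimes> snd z \<in> {a \<in> A. p a \<in> U}}"
    proof
      fix z assume "z \<in> {x} \<times> L"
      then obtain l where l: "z = (x, l)" "l \<in> L" by blast
      then have lA: "l \<in> A" using L(3) by blast
      have "inv x \<otimes> (x \<otimes> l) = l" using x lA A_sub by (simp add: subset_iff)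
      then have "p x = p (x \<otimes> l)" using p_eq_iff[of x "x \<otimes> l"] x lA l(2) by simp
      then show "z \<in> {z \<in> A \<times> A. fst z \<otimes> snd z \<in> {a \<in> A. p a \<in> U}}" using l x lA U(2) by simp
    qed
    have cx: "compactin ?TA {x}" using x topspace_A by simp
    obtain Y V where YV: "openin ?TA Y" "openin ?TA V" "{x} \<subseteq> Y" "L \<subseteq> V"
      "Y \<times> V \<subseteq> {z \<in> A \<times> A. fst z \<otimes> snd z \<in> {a \<in> A. p a \<in> U}}"
      by (rule Wallace_theorem_prod_topology[OF cx LA op sub])
    have "p (y \<otimes> v) \<in> U" if "y \<in> Y" "v \<in> V" for y v using YV(5) that by auto
    then show ?thesis using YV U by (intro exI[of _ Y] exI[of _ V] exI[of _ U]) auto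
  qed
  then obtain Y V U where YVU: "\<And>x. x \<in> A \<Longrightarrow> openin ?TA (Y x) \<and> openin ?TA (V x) \<and> x \<in> Y x \<and> L \<subseteq> V x \<and>
      U x \<in> \<U> \<and> (\<forall>y\<in>Y x. \<forall>v\<in>V x. p (y \<otimes> v) \<in> U x)" by metis
  have "\<forall>N\<in>Y ` A. openin ?TA N" using YVU by auto
  moreover have "topspace ?TA \<subseteq> \<Union>(Y ` A)" unfolding topspace_A using YVU by auto
  ultimately obtain \<F> where \<F>: "finite \<F>" "\<F> \<subseteq> Y ` A" "A \<subseteq> \<Union>\<F>"
    using compact_A[unfolded compact_space_alt topspace_A, rule_format, of "Y ` A"]
    unfolding topspace_A by auto
  then obtain Z where Z: "finite Z" "Z \<subseteq> A" "\<F> = Y ` Z" by (meson finite_subset_image)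
  have "\<one> \<in> \<Union>(Y ` Z)" using \<F>(3) Z(3) A.one_closed by blast
  then have "Z \<noteq> {}" by blast
  then have "openin ?TA (\<Inter>x\<in>Z. V x)" using Z YVU by (intro openin_INT2) auto
  \<comment> \<open>The intersection is open in \<open>A\<close> only, while the biinvariant
    neighbourhood is formed in the ambient group; hence the extension to \<open>O'\<close>.\<close>
  then obtain O' where O': "openin T O'" "(\<Inter>x\<in>Z. V x) = O' \<inter> A" unfolding openin_subtopology by blast
  have "L \<subseteq> (\<Inter>x\<in>Z. V x)" using YVU Z(2) by blast
  then have "L \<subseteq> O'" using O'(2) by blast
  from ex_biinvariant_nbhd[OF L(1,2) O'(1) this]
  obtain W where W: "openin T W" "L \<subseteq> W" "W \<subseteq> O'" "\<forall>w\<in>W. inv w \<in> W"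
    "\<forall>l\<in>L. \<forall>w\<in>W. l \<otimes> w \<in> W \<and> w \<otimes> l \<in> W" by blast
  have "\<exists>U\<in>\<U>. \<forall>w\<in>W. x \<otimes> w \<in> A \<longrightarrow> p (x \<otimes> w) \<in> U" if x: "x \<in> A" for x
  proof -
    obtain z where z: "z \<in> Z" "x \<in> Y z" using \<F>(3) Z(3) x by blast
    have "p (x \<otimes> w) \<in> U z" if w: "w \<in> W" "x \<otimes> w \<in> A" for w
    proof -
      have wG: "w \<in> carrier G" using w(1) openin_subset[OF W(1)] topspace_eq by auto
      have "w = inv x \<otimes> (x \<otimes> w)" using x wG A_sub by (simp add: subset_iff)
      also have "\<dots> \<in> A" using x w(2) by simp
      finally have "w \<in> V z" using O'(2) w(1) W(3) z(1) by blast
      then show ?thesis using YVU z Z(2) by blast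
    qed
    then show ?thesis using YVU z(1) Z(2) by blast
  qed
  then show ?thesis using W by blast
qed

text \<open>The cover is fixed before \<open>F\<close>: its members are the images of the sets A
  \<inter> xW, where W^-1 W \<subseteq> O'. Two points sharing a choice function have, for each s
  \<in> F, their images under \<open>\<rho> s\<close> in a common xW, hence differ by an element of
  \<open>bowen F O'\<close>. A separated set therefore injects into the choices, and in particular
  is finite.\<close>

lemma ex_cover_separated_le:
  assumes O': "openin T O'" "L \<subseteq> O'"
  shows "\<exists>\<U>. open_cover X \<U> \<and> (\<forall>F B. finite F \<longrightarrow> F \<noteq> {} \<longrightarrow> F \<subseteq> carrier S \<longrightarrow> B \<subseteq> A \<longrightarrow> separated F O' B \<longrightarrow>
    finite B \<and> card B \<le> cover_number X (cover_along X \<sigma> \<U> F))"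
proof -
  interpret A: subgroup A G by (rule A(1))
  obtain W where W: "openin T W" "L \<subseteq> W" 
    "\<forall>l\<in>L. \<forall>w\<in>W. l \<otimes> w \<in> W \<and> w \<otimes> l \<in> W" "\<forall>w\<in>W. \<forall>w'\<in>W. inv w \<otimes> w' \<in> O'"
    using ex_biinvariant_nbhd[OF L(1,2) O'] by blast
  have WG: "W \<subseteq> carrier G" using openin_subset[OF W(1)] topspace_eq by auto
  define N where "N = (\<lambda>x. {y \<in> A. inv x \<otimes> y \<in> W})"
  \<comment> \<open>WL \<subseteq> W makes \<open>N x\<close> a union of cosets of \<open>L\<close>,
    hence the full preimage of its image in \<open>A\<close>; this is why that image is
    open.\<close>
  have sat: "y \<in> N x" if "x \<in> A" "y \<in> A" "p y \<in> p ` N x" for x y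
  proof -
    obtain z where z: "z \<in> N x" "p y = p z" using \<open>p y \<in> p ` N x\<close> by blast
    have zA: "z \<in> A" using z by (simp add: N_def)
    then have "inv z \<otimes> y \<in> L" using p_eq_iff[of z y] z(2) that by simp
    then have "(inv x \<otimes> z) \<otimes> (inv z \<otimes> y) \<in> W" using W(3) z(1) by (simp add: N_def)
    moreover have "(inv x \<otimes> z) \<otimes> (inv z \<otimes> y) = inv x \<otimes> y"
    proof -
      have G: "x \<in> carrier G" "y \<in> carrier G" "z \<in> carrier G" using that zA A_sub by auto
      then show ?thesis using G by (simp add: m_assoc)
    qed
    ultimately show ?thesis using that by (simp add: N_def)
  qed
  define \<U> where "\<U> = (\<lambda>x. p ` N x) ` A"
  have "openin X (p ` N x)" if x: "x \<in> A" for x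
  proof -
    have "{a \<in> A. p a \<in> p ` N x} = N x" using sat[OF x] by (auto simp: N_def)
    moreover have "N x = {y \<in> carrier G. inv x \<otimes> y \<in> W} \<inter> A" using A_sub by (auto simp: N_def)
    moreover have "openin T {y \<in> carrier G. inv x \<otimes> y \<in> W}"
      by (rule openin_l_translate[OF W(1)]) (use x A_sub in auto)
    ultimately show ?thesis unfolding openin_X_iff by (auto simp: N_def openin_subtopology)
  qed
  moreover have "p x \<in> p ` N x" if "x \<in> A" for x
  proof -
    have "x \<in> N x" using that A_sub W(2) subgroup.one_closed[OF L(1)] by (auto simp: N_def subset_iff)
    then show ?thesis by blast
  qed
  moreover have "p ` N x \<subseteq> p ` A" for x by (auto simp: N_def)
  ultimately have cov: "open_cover X \<U>"
    unfolding open_cover_def \<U>_def topspace_X by (intro conjI equalityI) (fast, fast, fast)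
  have "finite B \<and> card B \<le> cover_number X (cover_along X \<sigma> \<U> F)"
    if F: "finite F" "F \<noteq> {}" "F \<subseteq> carrier S" and B: "B \<subseteq> A" "separated F O' B" for F B
  proof -
    obtain \<Phi> where \<Phi>: "cover_choices X \<sigma> \<U> F \<Phi>" "card \<Phi> \<le> cover_number X (cover_along X \<sigma> \<U> F)"
      using cover_number_attained[OF compact_X cov F(1,2), of \<sigma>] continuous_sigma F(3) by blast
    have "\<forall>b\<in>B. \<exists>\<phi>\<in>\<Phi>. \<forall>s\<in>F. \<sigma> s (p b) \<in> \<phi> s"
      using \<Phi>(1) B(1) topspace_X unfolding cover_choices_def by blast
    then obtain g where g: "\<And>b. b \<in> B \<Longrightarrow> g b \<in> \<Phi> \<and> (\<forall>s\<in>F. \<sigma> s (p b) \<in> g b s)" by metis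
    have "inj_on g B"
    proof (rule inj_onI, rule ccontr)
      fix b c assume bc: "b \<in> B" "c \<in> B" "g b = g c" "b \<noteq> c"
      have bcA: "b \<in> A" "c \<in> A" using bc B(1) by auto
      have bcG: "b \<in> carrier G" "c \<in> carrier G" using bcA A_sub by auto
      have "\<rho> s (inv b \<otimes> c) \<in> O'" if s: "s \<in> F" for s
      proof -
        have sS: "s \<in> carrier S" using s F by auto
        have "g b s \<in> \<U>" using g[OF bc(1)] \<Phi>(1) s unfolding cover_choices_def by blast
        then obtain x where x: "x \<in> A" "g b s = p ` N x" unfolding \<U>_def by blast
        have "p (\<rho> s b) \<in> p ` N x" "p (\<rho> s c) \<in> p ` N x"
          using g[OF bc(1)] g[OF bc(2)] s bc(3) x(2) sigma[OF sS] bcA by auto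
        then have "\<rho> s b \<in> N x" "\<rho> s c \<in> N x" using sat x(1) rho_A[OF sS] bcA by auto
        then have "inv (inv x \<otimes> \<rho> s b) \<otimes> (inv x \<otimes> \<rho> s c) \<in> O'" using W(4) by (simp add: N_def)
        moreover have "inv (inv x \<otimes> \<rho> s b) \<otimes> (inv x \<otimes> \<rho> s c) = \<rho> s (inv b \<otimes> c)"
        proof -
          have xG: "x \<in> carrier G" using x A_sub by auto
          then show ?thesis using xG sS bcG by (simp add: inv_mult_group m_assoc)
        qed
        ultimately show ?thesis by simp
      qed
      then have "inv b \<otimes> c \<in> bowen F O'" using bcG by (simp add: bowen_def)
      then show False using B(2) bc unfolding separated_def by blast
    qed
    moreover have "g ` B \<subseteq> \<Phi>" "finite \<Phi>" using g \<Phi>(1) by (auto simp: cover_choices_def)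
    ultimately have "finite B" "card B \<le> card \<Phi>" by (meson inj_on_finite, meson card_inj_on_le)
    then show ?thesis using \<Phi>(2) by simp
  qed
  then show ?thesis using cov by blast
qed

text \<open>A separated set of greatest size exists because a cover number bounds all sizes, and a
  point outside all its balls could be added to it. Symmetry of \<open>O'\<close> settles both
  orders in which a new point is compared with the old ones.\<close>

lemma ex_spanning_separated:
  assumes O': "openin T O'" "L \<subseteq> O'" "\<forall>w\<in>O'. inv w \<in> O'"
    and F: "finite F" "F \<noteq> {}" "F \<subseteq> carrier S"
  shows "\<exists>B\<subseteq>A. finite B \<and> separated F O' B \<and> (\<forall>x\<in>A. \<exists>b\<in>B. inv b \<otimes> x \<in> bowen F O')"
proof -
  from ex_cover_separated_le[OF O'(1,2)] obtain \<U> where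
    "\<forall>F B. finite F \<longrightarrow> F \<noteq> {} \<longrightarrow> F \<subseteq> carrier S \<longrightarrow> B \<subseteq> A \<longrightarrow> separated F O' B \<longrightarrow>
      finite B \<and> card B \<le> cover_number X (cover_along X \<sigma> \<U> F)" by (elim exE conjE)
  then have \<U>: "finite B \<and> card B \<le> cover_number X (cover_along X \<sigma> \<U> F)"
    if "B \<subseteq> A" "separated F O' B" for B
    using F that by simp
  have "\<forall>B. B \<subseteq> A \<and> separated F O' B \<longrightarrow> card B < Suc (cover_number X (cover_along X \<sigma> \<U> F))"
    using \<U> by (simp add: less_Suc_eq_le)
  moreover have "{} \<subseteq> A \<and> separated F O' {}" by (simp add: separated_def)
  ultimately obtain B where B: "B \<subseteq> A" "separated F O' B"
    and max: "\<And>C. C \<subseteq> A \<Longrightarrow> separated F O' C \<Longrightarrow> card C \<le> card B"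
    using ex_has_greatest_nat[of "\<lambda>B. B \<subseteq> A \<and> separated F O' B" "{}" card] by metis
  have finB: "finite B" using \<U> B by blast
  have "\<exists>b\<in>B. inv b \<otimes> x \<in> bowen F O'" if x: "x \<in> A" for x
  proof (rule ccontr)
    assume no: "\<not> ?thesis"
    have xG: "x \<in> carrier G" and BG: "\<And>b. b \<in> B \<Longrightarrow> b \<in> carrier G" using x B A_sub by auto
    have "\<one> \<in> bowen F O'" using one_in_bowen F O'(2) subgroup.one_closed[OF L(1)] by blast
    then have "x \<notin> B" using no xG by force
    have "inv x \<otimes> b \<notin> bowen F O'" if b: "b \<in> B" for b
    proof
      assume "inv x \<otimes> b \<in> bowen F O'"
      then have "inv (inv x \<otimes> b) \<in> bowen F O'" by (rule bowen_inv[OF F(3) O'(3)])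
      then show False using no b xG BG[OF b] by (simp add: inv_mult_group)
    qed
    then have "separated F O' (insert x B)" using B(2) no unfolding separated_def by blast
    then have "card (insert x B) \<le> card B" using max x B(1) by simp
    then show False using finB \<open>x \<notin> B\<close> by simp
  qed
  then show ?thesis using B finB by blast
qed

text \<open>If x lies in the ball around c, then \<open>\<rho> s x\<close> lies in the translate of
  \<open>W\<close> by \<open>\<rho> s c\<close>, which the Lebesgue property puts into one member of
  the cover; so each centre yields one choice function. Together with the bound on separated sets,
  cover numbers can be exchanged for sizes of separated spanning sets at scales independent of
  \<open>F\<close>.\<close>

lemma cover_number_le_spanning:
  assumes leb: "\<forall>x\<in>A. \<exists>U\<in>\<U>. \<forall>w\<in>W. x \<otimes> w \<in> A \<longrightarrow> p (x \<otimes> w) \<in> U"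
    and F: "F \<noteq> {}" "F \<subseteq> carrier S"
    and C: "finite C" "C \<subseteq> A" "\<forall>x\<in>A. \<exists>c\<in>C. inv c \<otimes> x \<in> bowen F W"
  shows "cover_number X (cover_along X \<sigma> \<U> F) \<le> card C"
proof -
  from leb obtain u where u: "\<And>x. x \<in> A \<Longrightarrow> u x \<in> \<U> \<and> (\<forall>w\<in>W. x \<otimes> w \<in> A \<longrightarrow> p (x \<otimes> w) \<in> u x)"
    by metis
  have "cover_choices X \<sigma> \<U> F ((\<lambda>c s. u (\<rho> s c)) ` C)"
    unfolding cover_choices_def
  proof (intro conjI ballI)
    fix \<phi> s assume "\<phi> \<in> (\<lambda>c s. u (\<rho> s c)) ` C" "s \<in> F"
    then obtain c where c: "c \<in> C" "\<phi> s = u (\<rho> s c)" and "s \<in> F" by blast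
    have "\<rho> s c \<in> A" by (rule rho_A) (use \<open>s \<in> F\<close> c(1) C(2) F(2) in auto)
    then show "\<phi> s \<in> \<U>" using u c(2) by simp
  next
    fix y assume "y \<in> topspace X"
    then obtain x where x: "x \<in> A" "y = p x" using topspace_X by auto
    then obtain c where c: "c \<in> C" "inv c \<otimes> x \<in> bowen F W" using C(3) by blast
    have "\<sigma> s y \<in> u (\<rho> s c)" if s: "s \<in> F" for s
    proof -
      have sS: "s \<in> carrier S" and cA: "c \<in> A" and G: "c \<in> carrier G" "x \<in> carrier G"
        using s F c C x A_sub by auto
      have "\<rho> s c \<otimes> \<rho> s (inv c \<otimes> x) = \<rho> s x" using sS G by simp
      moreover have "\<rho> s (inv c \<otimes> x) \<in> W" using c(2) s by (simp add: bowen_def)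
      moreover have "\<rho> s x \<in> A" using rho_A sS x by blast
      ultimately have "p (\<rho> s x) \<in> u (\<rho> s c)" using u[OF rho_A[OF sS cA]] by metis
      then show ?thesis using sigma sS x by simp
    qed
    then show "\<exists>\<phi>\<in>(\<lambda>c s. u (\<rho> s c)) ` C. \<forall>s\<in>F. \<sigma> s y \<in> \<phi> s"
      using c(1) by (intro bexI[of _ "\<lambda>s. u (\<rho> s c)"]) auto
  qed (use C in auto)
  then have "cover_number X (cover_along X \<sigma> \<U> F) \<le> card ((\<lambda>c s. u (\<rho> s c)) ` C)"
    by (rule cover_number_le_card[OF F(1)])
  also have "\<dots> \<le> card C" using C(1) by (rule card_image_le)
  finally show ?thesis .
qed

end

section \<open>Additivity\<close>

lemma quotient_map_ident: "quotient_map X X (\<lambda>x. x)"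
proof -
  have "{x \<in> topspace X. x \<in> U} = U" if "U \<subseteq> topspace X" for U using that by auto
  then show ?thesis by (simp add: quotient_map_def)
qed

context compact_group_action
begin

text \<open>Makes the trivial subgroup admissible as \<open>L\<close>, so that K and
  \<open>H\<close> are themselves treated as coset spaces.\<close>

lemma closedin_one: "closedin T {\<one>}"
  using Hausdorff topspace_eq by (simp add: closedin_Hausdorff_singleton)

lemma coset_spaces:
  assumes H: "subgroup H G" "closedin T H" "invariant_under S \<rho> H"
  shows coset_space_trivial: "coset_space_action G T S \<rho> (carrier G) {\<one>} T (\<lambda>x. x) \<rho>"
    and coset_space_subgroup: "coset_space_action G T S \<rho> H {\<one>} (subtopology T H) (\<lambda>x. x) (restricted_action \<rho> H)"
    and coset_space_quotient:
      "coset_space_action G T S \<rho> (carrier G) H (coset_topology G T H) (\<lambda>k. k <# H) (coset_action G \<rho> H)"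
proof -
  interpret H: subgroup H G by fact
  have one: "subgroup {\<one>} G" by (rule triv_subgroup)
  have carr: "subgroup (carrier G) G" "closedin T (carrier G)"
    using subgroup_self closedin_topspace[of T] topspace_eq by simp_all
  have inv_carr: "invariant_under S \<rho> (carrier G)" by (auto simp: invariant_under_def)
  have sub_carr: "subtopology T (carrier G) = T" by (metis subtopology_topspace topspace_eq)
  have eq_iff: "x = y \<longleftrightarrow> inv x \<otimes> y \<in> {\<one>}" if "x \<in> carrier G" "y \<in> carrier G" for x y
    using that by (metis inv_closed inv_inv inv_equality l_inv singleton_iff)
  show "coset_space_action G T S \<rho> (carrier G) {\<one>} T (\<lambda>x. x) \<rho>"
  proof unfold_locales
    show "quotient_map (subtopology T (carrier G)) T (\<lambda>x. x)"
      unfolding sub_carr by (rule quotient_map_ident)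
  qed (fact carr one closedin_one inv_carr eq_iff refl | simp)+
  show "coset_space_action G T S \<rho> H {\<one>} (subtopology T H) (\<lambda>x. x) (restricted_action \<rho> H)"
  proof unfold_locales
    show "x = y \<longleftrightarrow> inv x \<otimes> y \<in> {\<one>}" if "x \<in> H" "y \<in> H" for x y
      using that H.subset by (intro eq_iff) auto
  qed (fact H one closedin_one quotient_map_ident | simp add: restricted_action_def)+
  show "coset_space_action G T S \<rho> (carrier G) H (coset_topology G T H) (\<lambda>k. k <# H) (coset_action G \<rho> H)"
  proof unfold_locales
    show "quotient_map (subtopology T (carrier G)) (coset_topology G T H) (\<lambda>k. k <# H)"
      unfolding sub_carr coset_topology_def by (rule quotient_map_quotient_topology)
    show "coset_action G \<rho> H s (x <# H) = \<rho> s x <# H" if "s \<in> carrier S" "x \<in> carrier G" for s x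
      by (rule coset_action_l_coset[OF is_group H(1) group_action H(3) that])
    show "x <# H = y <# H \<longleftrightarrow> inv x \<otimes> y \<in> H" if xy: "x \<in> carrier G" "y \<in> carrier G" for x y
    proof
      assume "x <# H = y <# H"
      moreover have "y \<otimes> \<one> \<in> y <# H" using H.one_closed unfolding l_coset_def by blast
      ultimately have "y \<in> x <# H" using xy by simp
      then obtain h where "h \<in> H" "y = x \<otimes> h" unfolding l_coset_def by auto
      then show "inv x \<otimes> y \<in> H" using xy H.subset by (simp add: subset_iff)
    next
      assume h: "inv x \<otimes> y \<in> H"
      then have "x \<otimes> (inv x \<otimes> y) \<in> x <# H" unfolding l_coset_def by blast
      then have "y \<in> x <# H" using xy by simp
      then show "x <# H = y <# H" by (rule l_repr_independence[OF _ xy(1) H(1)])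
    qed
  qed (use carr H inv_carr H.subset in auto)
qed

text \<open>Products bh and bh' are compared inside \<open>H\<close>. For b \<noteq> b' one has b^-1
  b' = h (h^-1 b^-1 b' h') h'^-1; under each \<open>\<rho> s\<close> the outer factors stay in
  \<open>H\<close>, so they can be stripped off without leaving \<open>W2\<close>. The invariance of
  \<open>W2\<close> on both sides stands in for normality.\<close>

lemma separated_product:
  assumes F: "F \<subseteq> carrier S" and H: "subgroup H G" "invariant_under S \<rho> H"
    and B: "B1 \<subseteq> H" "separated F W1 B1" "B2 \<subseteq> carrier G" "separated F W2 B2"
    and W: "\<one> \<in> W1 \<inter> W2" "W2 \<subseteq> carrier G" "\<forall>l\<in>H. \<forall>w\<in>W2. l \<otimes> w \<in> W2 \<and> w \<otimes> l \<in> W2"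
  shows "separated F (W1 \<inter> W2) ((\<lambda>(b, h). b \<otimes> h) ` (B2 \<times> B1))"
    and "inj_on (\<lambda>(b, h). b \<otimes> h) (B2 \<times> B1)"
proof -
  interpret H: subgroup H G by fact
  have HS: "\<rho> s h \<in> H" if "s \<in> F" "h \<in> H" for s h
    using that H(2) F unfolding invariant_under_def by blast
  have apart: "inv (b \<otimes> h) \<otimes> (b' \<otimes> h') \<notin> bowen F (W1 \<inter> W2)"
    if bh: "b \<in> B2" "b' \<in> B2" "h \<in> B1" "h' \<in> B1" and neq: "b \<noteq> b' \<or> h \<noteq> h'" for b h b' h'
  proof
    assume asm: "inv (b \<otimes> h) \<otimes> (b' \<otimes> h') \<in> bowen F (W1 \<inter> W2)"
    have hH: "h \<in> H" "h' \<in> H" using bh B(1) by auto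
    have G: "b \<in> carrier G" "b' \<in> carrier G" "h \<in> carrier G" "h' \<in> carrier G"
      using bh B H.subset by auto
    show False
    proof (cases "b = b'")
      case True
      have "inv (b \<otimes> h) \<otimes> (b' \<otimes> h') = inv h \<otimes> h'" using True G by (simp add: inv_mult_group m_assoc)
      then have "inv h \<otimes> h' \<in> bowen F W1" using asm by (auto simp: bowen_def)
      then show False using B(2) bh neq True unfolding separated_def by blast
    next
      case False
      have "\<rho> s (inv b \<otimes> b') \<in> W2" if s: "s \<in> F" for s
      proof -
        have sS: "s \<in> carrier S" using s F by blast
        have "\<rho> s (inv (b \<otimes> h) \<otimes> (b' \<otimes> h')) \<in> W2" using asm s by (simp add: bowen_def)
        then have "\<rho> s h \<otimes> \<rho> s (inv (b \<otimes> h) \<otimes> (b' \<otimes> h')) \<otimes> inv (\<rho> s h') \<in> W2"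
          using W(3) HS[OF s hH(1)] HS[OF s hH(2)] by simp
        moreover have "\<rho> s h \<otimes> \<rho> s (inv (b \<otimes> h) \<otimes> (b' \<otimes> h')) \<otimes> inv (\<rho> s h') = \<rho> s (inv b \<otimes> b')"
          using G sS by (simp add: inv_mult_group m_assoc)
        ultimately show ?thesis by simp
      qed
      then have "inv b \<otimes> b' \<in> bowen F W2" using G by (simp add: bowen_def)
      then show False using B(4) bh False unfolding separated_def by blast
    qed
  qed
  show "separated F (W1 \<inter> W2) ((\<lambda>(b, h). b \<otimes> h) ` (B2 \<times> B1))"
    unfolding separated_def
  proof (intro ballI impI)
    fix x y assume "x \<in> (\<lambda>(b, h). b \<otimes> h) ` (B2 \<times> B1)" "y \<in> (\<lambda>(b, h). b \<otimes> h) ` (B2 \<times> B1)"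
    then obtain b h b' h' where bh: "b \<in> B2" "b' \<in> B2" "h \<in> B1" "h' \<in> B1" "x = b \<otimes> h" "y = b' \<otimes> h'"
      by auto
    assume "x \<noteq> y"
    then have "b \<noteq> b' \<or> h \<noteq> h'" using bh(5,6) by auto
    then show "inv x \<otimes> y \<notin> bowen F (W1 \<inter> W2)" using apart bh by simp
  qed
  \<comment> \<open>Equal products would have quotient \<one>, which lies in the Bowen
    neighbourhood, contrary to \<open>apart\<close>.\<close>
  show "inj_on (\<lambda>(b, h). b \<otimes> h) (B2 \<times> B1)"
  proof (rule inj_onI, clarify, rule ccontr)
    fix b h b' h' assume bh: "b \<in> B2" "h \<in> B1" "b' \<in> B2" "h' \<in> B1" "b \<otimes> h = b' \<otimes> h'"
      and "\<not> (b = b' \<and> h = h')"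
    then have "inv (b \<otimes> h) \<otimes> (b' \<otimes> h') \<notin> bowen F (W1 \<inter> W2)" by (intro apart) auto
    moreover have "b' \<otimes> h' \<in> carrier G" using bh B H.subset by auto
    ultimately show False using one_in_bowen[OF F W(1)] bh(5) by simp
  qed
qed

text \<open>\<open>W1\<close> and \<open>W2\<close> are Lebesgue neighbourhoods for the given
  covers, and \<U> comes from their intersection, all before \<open>F\<close> is known. For each
  \<open>F\<close>, maximal separated sets dominate the two cover numbers, and their product set is
  bounded by the cover number of \<U>.\<close>

lemma cover_number_superadditive:
  assumes H: "subgroup H G" "closedin T H" "invariant_under S \<rho> H"
    and \<V>: "open_cover (subtopology T H) \<V>" and \<W>: "open_cover (coset_topology G T H) \<W>"
  shows "\<exists>\<U>. open_cover T \<U> \<and> (\<forall>F. finite F \<longrightarrow> F \<noteq> {} \<longrightarrow> F \<subseteq> carrier S \<longrightarrow>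
    cover_number (subtopology T H) (cover_along (subtopology T H) (restricted_action \<rho> H) \<V> F) *
    cover_number (coset_topology G T H) (cover_along (coset_topology G T H) (coset_action G \<rho> H) \<W> F)
    \<le> cover_number T (cover_along T \<rho> \<U> F))"
proof -
  interpret K: coset_space_action G T S \<rho> "carrier G" "{\<one>}" T "\<lambda>x. x" \<rho>
    using H by (rule coset_space_trivial)
  interpret H: coset_space_action G T S \<rho> H "{\<one>}" "subtopology T H" "\<lambda>x. x" "restricted_action \<rho> H"
    using H by (rule coset_space_subgroup)
  interpret Q: coset_space_action G T S \<rho> "carrier G" H "coset_topology G T H" "\<lambda>k. k <# H" "coset_action G \<rho> H"
    using H by (rule coset_space_quotient)
  obtain W1 where W1: "openin T W1" "{\<one>} \<subseteq> W1" "\<forall>w\<in>W1. inv w \<in> W1"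
    "\<forall>x\<in>H. \<exists>U\<in>\<V>. \<forall>w\<in>W1. x \<otimes> w \<in> H \<longrightarrow> x \<otimes> w \<in> U"
    using H.lebesgue_nbhd[OF \<V>] by (elim exE conjE)
  obtain W2 where W2: "openin T W2" "H \<subseteq> W2" "\<forall>w\<in>W2. inv w \<in> W2"
    "\<forall>l\<in>H. \<forall>w\<in>W2. l \<otimes> w \<in> W2 \<and> w \<otimes> l \<in> W2"
    "\<forall>x\<in>carrier G. \<exists>U\<in>\<W>. \<forall>w\<in>W2. x \<otimes> w \<in> carrier G \<longrightarrow> (x \<otimes> w) <# H \<in> U"
    using Q.lebesgue_nbhd[OF \<W>] by (elim exE conjE)
  have one: "\<one> \<in> W1 \<inter> W2" using W1(2) W2(2) subgroup.one_closed[OF H(1)] by auto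
  have W: "openin T (W1 \<inter> W2)" "{\<one>} \<subseteq> W1 \<inter> W2" using W1(1) W2(1) one by auto
  obtain \<U> where \<U>: "open_cover T \<U>"
    "\<forall>F B. finite F \<longrightarrow> F \<noteq> {} \<longrightarrow> F \<subseteq> carrier S \<longrightarrow> B \<subseteq> carrier G \<longrightarrow> separated F (W1 \<inter> W2) B \<longrightarrow>
      finite B \<and> card B \<le> cover_number T (cover_along T \<rho> \<U> F)"
    using K.ex_cover_separated_le[OF W] by (elim exE conjE)
  have "cover_number (subtopology T H) (cover_along (subtopology T H) (restricted_action \<rho> H) \<V> F) *
    cover_number (coset_topology G T H) (cover_along (coset_topology G T H) (coset_action G \<rho> H) \<W> F)
    \<le> cover_number T (cover_along T \<rho> \<U> F)" (is "?n1 * ?n2 \<le> _")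
    if F: "finite F" "F \<noteq> {}" "F \<subseteq> carrier S" for F
  proof -
    obtain B1 where B1: "B1 \<subseteq> H" "finite B1" "separated F W1 B1" "\<forall>x\<in>H. \<exists>b\<in>B1. inv b \<otimes> x \<in> bowen F W1"
      using H.ex_spanning_separated[OF W1(1-3) F] by (elim exE conjE)
    obtain B2 where B2: "B2 \<subseteq> carrier G" "finite B2" "separated F W2 B2"
      "\<forall>x\<in>carrier G. \<exists>b\<in>B2. inv b \<otimes> x \<in> bowen F W2"
      using Q.ex_spanning_separated[OF W2(1-3) F] by (elim exE conjE)
    have n1: "?n1 \<le> card B1" by (rule H.cover_number_le_spanning[OF W1(4) F(2,3) B1(2,1,4)])
    have n2: "?n2 \<le> card B2" by (rule Q.cover_number_le_spanning[OF W2(5) F(2,3) B2(2,1,4)])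
    have "W2 \<subseteq> carrier G" using openin_subset[OF W2(1)] topspace_eq by simp
    note sep = separated_product[OF F(3) H(1,3) B1(1,3) B2(1,3) one this W2(4)]
    have "(\<lambda>(b, h). b \<otimes> h) ` (B2 \<times> B1) \<subseteq> carrier G"
      using B1(1) B2(1) H.A_sub by auto
    then have "card ((\<lambda>(b, h). b \<otimes> h) ` (B2 \<times> B1)) \<le> cover_number T (cover_along T \<rho> \<U> F)"
      using \<U>(2) F sep(1) by simp
    then have "card B2 * card B1 \<le> cover_number T (cover_along T \<rho> \<U> F)"
      using card_image[OF sep(2)] by (simp add: card_cartesian_product)
    moreover have "?n1 * ?n2 \<le> card B1 * card B2" using n1 n2 by (rule mult_le_mono)
    ultimately show ?thesis by (simp add: mult.commute)
  qed
  then show ?thesis using \<U>(1) by (intro exI[of _ \<U>]) simp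
qed

text \<open>Each tile \<open>(c, E)\<close> contributes a choice of one of the \<open>(E, V)\<close>-balls that cover a neighbourhood
  \<open>W2\<close> of \<open>H\<close>, since \<open>\<rho> c\<close> maps each \<open>(F, W2)\<close>-ball into a translate of \<open>W2\<close>.\<close>

lemma cover_number_subadditive:
  assumes H: "subgroup H G" "closedin T H" "invariant_under S \<rho> H" and \<U>: "open_cover T \<U>"
  shows "\<exists>\<V>. open_cover (subtopology T H) \<V> \<and>
    (\<forall>\<E>. finite \<E> \<longrightarrow> (\<forall>E\<in>\<E>. E \<noteq> {} \<and> finite E \<and> E \<subseteq> carrier S) \<longrightarrow>
     (\<exists>\<W>. open_cover (coset_topology G T H) \<W> \<and> (\<forall>F Q. finite F \<longrightarrow> F \<noteq> {} \<longrightarrow> F \<subseteq> carrier S \<longrightarrow>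
       finite Q \<longrightarrow> Q \<subseteq> F \<times> \<E> \<longrightarrow> F = (\<Union>(c, E)\<in>Q. (\<otimes>\<^bsub>S\<^esub>) c ` E) \<longrightarrow>
       cover_number T (cover_along T \<rho> \<U> F)
       \<le> cover_number (coset_topology G T H) (cover_along (coset_topology G T H) (coset_action G \<rho> H) \<W> F) *
         (\<Prod>(c, E)\<in>Q. cover_number (subtopology T H) (cover_along (subtopology T H) (restricted_action \<rho> H) \<V> E)))))"
proof -
  interpret K: coset_space_action G T S \<rho> "carrier G" "{\<one>}" T "\<lambda>x. x" \<rho>
    using H by (rule coset_space_trivial)
  interpret H: coset_space_action G T S \<rho> H "{\<one>}" "subtopology T H" "\<lambda>x. x" "restricted_action \<rho> H"
    using H by (rule coset_space_subgroup)
  interpret Q: coset_space_action G T S \<rho> "carrier G" H "coset_topology G T H" "\<lambda>k. k <# H" "coset_action G \<rho> H"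
    using H by (rule coset_space_quotient)
  obtain W where W: "openin T W" "{\<one>} \<subseteq> W"
    "\<forall>x\<in>carrier G. \<exists>U\<in>\<U>. \<forall>w\<in>W. x \<otimes> w \<in> carrier G \<longrightarrow> x \<otimes> w \<in> U"
    using K.lebesgue_nbhd[OF \<U>] by (elim exE conjE)
  \<comment> \<open>At this scale two points in one translate of \<open>V\<close> differ by an
    element of \<open>W\<close>, the Lebesgue neighbourhood of \<U>.\<close>
  obtain V where V: "openin T V" "{\<one>} \<subseteq> V" "\<forall>w\<in>V. inv w \<in> V" "\<forall>w\<in>V. \<forall>w'\<in>V. inv w \<otimes> w' \<in> W"
    using ex_biinvariant_nbhd[OF K.L(1,2) W(1,2)] by (elim exE conjE)
  obtain \<V> where \<V>: "open_cover (subtopology T H) \<V>"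
    "\<forall>F B. finite F \<longrightarrow> F \<noteq> {} \<longrightarrow> F \<subseteq> carrier S \<longrightarrow> B \<subseteq> H \<longrightarrow> separated F V B \<longrightarrow> finite B \<and> card B \<le>
      cover_number (subtopology T H) (cover_along (subtopology T H) (restricted_action \<rho> H) \<V> F)"
    using H.ex_cover_separated_le[OF V(1,2)] by (elim exE conjE)
  let ?nH = "\<lambda>E. cover_number (subtopology T H) (cover_along (subtopology T H) (restricted_action \<rho> H) \<V> E)"
  have main: "\<exists>\<W>. open_cover (coset_topology G T H) \<W> \<and> (\<forall>F Q. finite F \<longrightarrow> F \<noteq> {} \<longrightarrow> F \<subseteq> carrier S \<longrightarrow>
       finite Q \<longrightarrow> Q \<subseteq> F \<times> \<E> \<longrightarrow> F = (\<Union>(c, E)\<in>Q. (\<otimes>\<^bsub>S\<^esub>) c ` E) \<longrightarrow>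
       cover_number T (cover_along T \<rho> \<U> F)
       \<le> cover_number (coset_topology G T H) (cover_along (coset_topology G T H) (coset_action G \<rho> H) \<W> F) *
         (\<Prod>(c, E)\<in>Q. ?nH E))"
    if \<E>: "finite \<E>" "\<forall>E\<in>\<E>. E \<noteq> {} \<and> finite E \<and> E \<subseteq> carrier S" for \<E>
  proof -
    have "\<exists>B\<subseteq>H. finite B \<and> separated E V B \<and> (\<forall>x\<in>H. \<exists>b\<in>B. inv b \<otimes> x \<in> bowen E V)" if "E \<in> \<E>" for E
      by (rule H.ex_spanning_separated[OF V(1-3)]) (use \<E> that in auto)
    then have "\<forall>E\<in>\<E>. \<exists>B. B \<subseteq> H \<and> finite B \<and> separated E V B \<and> (\<forall>x\<in>H. \<exists>b\<in>B. inv b \<otimes> x \<in> bowen E V)"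
      by simp
    from bchoice[OF this] obtain \<beta> where "\<forall>E\<in>\<E>. \<beta> E \<subseteq> H \<and> finite (\<beta> E) \<and> separated E V (\<beta> E) \<and>
        (\<forall>x\<in>H. \<exists>b\<in>\<beta> E. inv b \<otimes> x \<in> bowen E V)" ..
    then have \<beta>: "\<And>E. E \<in> \<E> \<Longrightarrow> \<beta> E \<subseteq> H" "\<And>E. E \<in> \<E> \<Longrightarrow> finite (\<beta> E)"
      "\<And>E. E \<in> \<E> \<Longrightarrow> separated E V (\<beta> E)"
      "\<And>E. E \<in> \<E> \<Longrightarrow> \<forall>x\<in>H. \<exists>b\<in>\<beta> E. inv b \<otimes> x \<in> bowen E V" by simp_all
    have card_\<beta>: "card (\<beta> E) \<le> ?nH E" if "E \<in> \<E>" for E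
      using \<V>(2) \<E>(2) that \<beta>(1,3)[OF that] by simp
    \<comment> \<open>The part of all of K, not only of \<open>H\<close>, reached by the balls
      around \<open>\<beta> E\<close>. It is an open neighbourhood of \<open>H\<close>, and as there
      are finitely many shapes one \<open>W2\<close> fits into all of them.\<close>
    define N where "N = (\<lambda>E. \<Union>b\<in>\<beta> E. {x \<in> carrier G. inv b \<otimes> x \<in> bowen E V})"
    have openN: "openin T (N E)" if "E \<in> \<E>" for E
    proof -
      have "openin T (bowen E V)" using openin_bowen \<E>(2) that V(1) by blast
      then have "openin T {x \<in> carrier G. inv b \<otimes> x \<in> bowen E V}" if "b \<in> \<beta> E" for b
        by (rule openin_l_translate) (use \<beta>(1)[OF \<open>E \<in> \<E>\<close>] that H.A_sub in auto)
      then show ?thesis unfolding N_def by auto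
    qed
    \<comment> \<open>Meeting with the space handles an empty \<E>, for which the bare intersection
      is the whole type.\<close>
    have "openin T (topspace T \<inter> \<Inter>(N ` \<E>))"
    proof (cases "\<E> = {}")
      case False
      then have "openin T (\<Inter>(N ` \<E>))" using openN \<E>(1) by (intro openin_INT2) auto
      then show ?thesis by auto
    qed simp
    moreover have "H \<subseteq> topspace T \<inter> \<Inter>(N ` \<E>)"
      using \<beta>(4) H.A_sub topspace_eq unfolding N_def by auto
    ultimately obtain W2 where W2: "openin T W2" "H \<subseteq> W2" "W2 \<subseteq> topspace T \<inter> \<Inter>(N ` \<E>)" "\<forall>w\<in>W2. inv w \<in> W2"
      using ex_biinvariant_nbhd[OF H(1,2)] by meson
    obtain \<W> where \<W>: "open_cover (coset_topology G T H) \<W>"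
      "\<forall>F B. finite F \<longrightarrow> F \<noteq> {} \<longrightarrow> F \<subseteq> carrier S \<longrightarrow> B \<subseteq> carrier G \<longrightarrow> separated F W2 B \<longrightarrow> finite B \<and> card B \<le>
        cover_number (coset_topology G T H) (cover_along (coset_topology G T H) (coset_action G \<rho> H) \<W> F)"
      using Q.ex_cover_separated_le[OF W2(1,2)] by (elim exE conjE)
    have bound: "cover_number T (cover_along T \<rho> \<U> F)
       \<le> cover_number (coset_topology G T H) (cover_along (coset_topology G T H) (coset_action G \<rho> H) \<W> F) *
         (\<Prod>(c, E)\<in>Q. ?nH E)" (is "_ \<le> ?nQ * _")
      if F: "finite F" "F \<noteq> {}" "F \<subseteq> carrier S" and Q: "finite Q" "Q \<subseteq> F \<times> \<E>"
        "F = (\<Union>(c, E)\<in>Q. (\<otimes>\<^bsub>S\<^esub>) c ` E)" for F Q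
    proof -
      obtain B2 where B2: "B2 \<subseteq> carrier G" "finite B2" "separated F W2 B2"
        "\<forall>x\<in>carrier G. \<exists>b\<in>B2. inv b \<otimes> x \<in> bowen F W2"
        using Q.ex_spanning_separated[OF W2(1,2,4) F] by (elim exE conjE)
      have card_B2: "card B2 \<le> ?nQ" using \<W>(2) F B2 by simp
      have qQ: "fst q \<in> F" "snd q \<in> \<E>" "fst q \<in> carrier S" "snd q \<subseteq> carrier S" if "q \<in> Q" for q
      proof -
        have "q \<in> F \<times> \<E>" using Q(2) that by blast
        then show "fst q \<in> F" "snd q \<in> \<E>" by (simp_all add: mem_Times_iff)
        then show "fst q \<in> carrier S" "snd q \<subseteq> carrier S" using F(3) \<E>(2) by blast+
      qed
      \<comment> \<open>Codes: a centre of a ball modulo \<open>H\<close> along \<open>F\<close>,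
        and for each tile a centre in \<open>H\<close>.\<close>
      define P where "P = B2 \<times> (\<Pi>\<^sub>E q\<in>Q. \<beta> (snd q))"
      have finP: "finite P" unfolding P_def using B2 Q(1) \<beta>(2) qQ by (intro finite_cartesian_product finite_PiE) auto
      have "\<exists>d\<in>P. \<forall>q\<in>Q. inv (snd d q) \<otimes> \<rho> (fst q) (inv (fst d) \<otimes> x) \<in> bowen (snd q) V"
        if x: "x \<in> carrier G" for x
      proof -
        obtain b where b: "b \<in> B2" "inv b \<otimes> x \<in> bowen F W2" using B2(4) x by blast
        have "\<exists>h\<in>\<beta> (snd q). inv h \<otimes> \<rho> (fst q) (inv b \<otimes> x) \<in> bowen (snd q) V" if q: "q \<in> Q" for q
        proof -
          have "\<rho> (fst q) (inv b \<otimes> x) \<in> W2" using b(2) qQ(1)[OF q] by (simp add: bowen_def)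
          then have "\<rho> (fst q) (inv b \<otimes> x) \<in> N (snd q)" using W2(3) qQ(2)[OF q] by blast
          then show ?thesis unfolding N_def by blast
        qed
        then obtain g where g: "\<And>q. q \<in> Q \<Longrightarrow> g q \<in> \<beta> (snd q) \<and> inv (g q) \<otimes> \<rho> (fst q) (inv b \<otimes> x) \<in> bowen (snd q) V"
          by metis
        have "(b, restrict g Q) \<in> P" using b g by (auto simp: P_def)
        then show ?thesis by (rule bexI[rotated]) (use g in simp)
      qed
      then obtain \<delta> where \<delta>: "\<And>x. x \<in> carrier G \<Longrightarrow> \<delta> x \<in> P"
        "\<And>x q. x \<in> carrier G \<Longrightarrow> q \<in> Q \<Longrightarrow>
          inv (snd (\<delta> x) q) \<otimes> \<rho> (fst q) (inv (fst (\<delta> x)) \<otimes> x) \<in> bowen (snd q) V" by metis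
      \<comment> \<open>A code need not come from a point of K, as its tile centres vary
        independently; one representative is taken for each code that occurs.\<close>
      define C where "C = inv_into (carrier G) \<delta> ` \<delta> ` carrier G"
      have \<delta>P: "\<delta> ` carrier G \<subseteq> P" using \<delta>(1) by auto
      have finC: "finite C" and "card C \<le> card P"
      proof -
        have "finite (\<delta> ` carrier G)" using \<delta>P finP by (rule finite_subset)
        then show "finite C" unfolding C_def by simp
        have "card C \<le> card (\<delta> ` carrier G)" unfolding C_def by (rule card_image_le) fact
        also have "\<dots> \<le> card P" by (rule card_mono[OF finP \<delta>P])
        finally show "card C \<le> card P" .
      qed
      have CG: "C \<subseteq> carrier G" unfolding C_def by (auto intro: inv_into_into)
      have span: "\<exists>c\<in>C. inv c \<otimes> x \<in> bowen F W" if x: "x \<in> carrier G" for x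
      proof -
        define c where "c = inv_into (carrier G) \<delta> (\<delta> x)"
        have cC: "c \<in> C" using x unfolding C_def c_def by simp
        have cG: "c \<in> carrier G" using cC CG by blast
        have \<delta>c: "\<delta> c = \<delta> x" unfolding c_def using x by (simp add: f_inv_into_f)
        define b where "b = fst (\<delta> x)"
        have bG: "b \<in> carrier G" using \<delta>(1)[OF x] B2(1) unfolding b_def P_def by auto
        have "\<rho> s (inv c \<otimes> x) \<in> W" if s: "s \<in> F" for s
        proof -
          obtain q e where q: "q \<in> Q" "e \<in> snd q" "s = fst q \<otimes>\<^bsub>S\<^esub> e" using s Q(3) by fastforce
          note qS = qQ(3)[OF q(1)]
          have eS: "e \<in> carrier S" using qQ(4)[OF q(1)] q(2) by blast
          define h where "h = snd (\<delta> x) q"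
          have "snd (\<delta> x) \<in> (\<Pi>\<^sub>E q\<in>Q. \<beta> (snd q))"
            using \<delta>(1)[OF x] unfolding P_def by (simp add: mem_Times_iff)
          then have "h \<in> \<beta> (snd q)" unfolding h_def using q(1) by (rule PiE_mem)
          then have hG: "h \<in> carrier G" using \<beta>(1)[OF qQ(2)[OF q(1)]] H.A_sub by blast
          have "\<rho> e (inv h \<otimes> \<rho> (fst q) (inv b \<otimes> c)) \<in> V"
            using \<delta>(2)[OF cG q(1)] q(2) unfolding \<delta>c h_def b_def by (simp add: bowen_def)
          moreover have "\<rho> e (inv h \<otimes> \<rho> (fst q) (inv b \<otimes> x)) \<in> V"
            using \<delta>(2)[OF x q(1)] q(2) unfolding h_def b_def by (simp add: bowen_def)
          ultimately have "inv (\<rho> e (inv h \<otimes> \<rho> (fst q) (inv b \<otimes> c))) \<otimes> \<rho> e (inv h \<otimes> \<rho> (fst q) (inv b \<otimes> x)) \<in> W"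
            using V(4) by blast
          \<comment> \<open>As \<open>c\<close> and \<open>x\<close> have the same code, both
            factors carry the same \<open>b\<close> and \<open>h\<close>, which cancel; applying
            \<rho> at \<open>fst q\<close> and then at \<open>e\<close> amounts to \<rho> at
            \<open>s\<close>.\<close>
          moreover have "inv (\<rho> e (inv h \<otimes> \<rho> (fst q) (inv b \<otimes> c))) \<otimes> \<rho> e (inv h \<otimes> \<rho> (fst q) (inv b \<otimes> x))
              = \<rho> s (inv c \<otimes> x)"
            using qS eS hG bG cG x unfolding q(3) by (simp add: rho_comp inv_mult_group m_assoc)
          ultimately show ?thesis by simp
        qed
        then have "inv c \<otimes> x \<in> bowen F W" using cG x by (simp add: bowen_def)
        then show ?thesis using cC by blast
      qed
      have "cover_number T (cover_along T \<rho> \<U> F) \<le> card C"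
        by (rule K.cover_number_le_spanning[OF W(3) F(2,3) finC CG]) (use span in blast)
      also have "\<dots> \<le> card P" by fact
      also have "\<dots> = card B2 * (\<Prod>q\<in>Q. card (\<beta> (snd q)))"
        unfolding P_def using Q(1) by (simp add: card_cartesian_product card_PiE)
      also have "\<dots> \<le> ?nQ * (\<Prod>q\<in>Q. ?nH (snd q))"
        using card_B2 card_\<beta> qQ(2) by (intro mult_le_mono prod_mono) auto
      finally show ?thesis by (simp add: case_prod_unfold)
    qed
    show ?thesis
      by (rule exI[of _ \<W>], intro conjI allI impI \<W>(1)) (rule bound; assumption)
  qed
  show ?thesis
    by (rule exI[of _ \<V>], intro conjI allI impI \<V>(1)) (rule main; assumption)
qed

section \<open>From cover numbers to entropies\<close>

lemma H_top_superadditive: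
  assumes S: "monoid_cancel S" and net: "right_folner_net S I r F"
    and H: "subgroup H G" "closedin T H" "invariant_under S \<rho> H"
    and \<V>: "open_cover (subtopology T H) \<V>" and \<W>: "open_cover (coset_topology G T H) \<W>"
  shows "\<exists>\<U>. open_cover T \<U> \<and> H_top I r F (subtopology T H) (restricted_action \<rho> H) \<V> +
    H_top I r F (coset_topology G T H) (coset_action G \<rho> H) \<W> \<le> H_top I r F T \<rho> \<U>"
proof -
  interpret K: coset_space_action G T S \<rho> "carrier G" "{\<one>}" T "\<lambda>x. x" \<rho>
    using H by (rule coset_space_trivial)
  interpret H: coset_space_action G T S \<rho> H "{\<one>}" "subtopology T H" "\<lambda>x. x" "restricted_action \<rho> H"
    using H by (rule coset_space_subgroup)
  interpret Q: coset_space_action G T S \<rho> "carrier G" H "coset_topology G T H" "\<lambda>k. k <# H" "coset_action G \<rho> H"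
    using H by (rule coset_space_quotient)
  have dir: "directed_preorder I r" using net unfolding right_folner_net_def by blast
  obtain \<U> where \<U>: "open_cover T \<U>" and le: "\<forall>F. finite F \<longrightarrow> F \<noteq> {} \<longrightarrow> F \<subseteq> carrier S \<longrightarrow>
    cover_number (subtopology T H) (cover_along (subtopology T H) (restricted_action \<rho> H) \<V> F) *
    cover_number (coset_topology G T H) (cover_along (coset_topology G T H) (coset_action G \<rho> H) \<W> F)
    \<le> cover_number T (cover_along T \<rho> \<U> F)"
    using cover_number_superadditive[OF H \<V> \<W>] by (elim exE conjE)
  note limK = H_top_tendsto[OF S net K.right_action_X K.compact_X K.topspace_X_nonempty \<U>]
  note limH = H_top_tendsto[OF S net H.right_action_X H.compact_X H.topspace_X_nonempty \<V>]
  note limQ = H_top_tendsto[OF S net Q.right_action_X Q.compact_X Q.topspace_X_nonempty \<W>]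
  have "H_top I r F (subtopology T H) (restricted_action \<rho> H) \<V> +
    H_top I r F (coset_topology G T H) (coset_action G \<rho> H) \<W> \<le> H_top I r F T \<rho> \<U>"
  proof (rule tendsto_le[OF net_filter_neq_bot[OF dir] limK(1) tendsto_add[OF limH(1) limQ(1)]])
    show "eventually (\<lambda>i. log_cover_number (subtopology T H) (restricted_action \<rho> H) \<V> (F i) / real (card (F i)) +
      log_cover_number (coset_topology G T H) (coset_action G \<rho> H) \<W> (F i) / real (card (F i))
      \<le> log_cover_number T \<rho> \<U> (F i) / real (card (F i))) (net_filter I r)"
      using eventually_in_net[OF dir]
    proof eventually_elim
      case (elim i)
      then have Fi: "finite (F i)" "F i \<noteq> {}" "F i \<subseteq> carrier S"
        using net unfolding right_folner_net_def by auto
      define m where "m = cover_number (subtopology T H) (cover_along (subtopology T H) (restricted_action \<rho> H) \<V> (F i))"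
      define n where "n = cover_number (coset_topology G T H) (cover_along (coset_topology G T H) (coset_action G \<rho> H) \<W> (F i))"
      define k where "k = cover_number T (cover_along T \<rho> \<U> (F i))"
      have "0 < m" unfolding m_def
        by (rule cover_number_pos[OF H.compact_X \<V> Fi(1,2) _ H.topspace_X_nonempty])
          (use H.continuous_sigma Fi(3) in blast)
      moreover have "0 < n" unfolding n_def
        by (rule cover_number_pos[OF Q.compact_X \<W> Fi(1,2) _ Q.topspace_X_nonempty])
          (use Q.continuous_sigma Fi(3) in blast)
      moreover have "m * n \<le> k" using le Fi unfolding m_def n_def k_def by blast
      then have "real m * real n \<le> real k" by (simp flip: of_nat_mult)
      ultimately have "ln (real m) + ln (real n) \<le> ln (real k)"
        by (subst ln_mult_pos[symmetric]) (auto intro!: ln_mono)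
      then show ?case unfolding m_def[symmetric] n_def[symmetric] k_def[symmetric]
        by (simp add: divide_right_mono flip: add_divide_distrib)
    qed
  qed
  then show ?thesis using \<U> by blast
qed

text \<open>The cover of \<open>H\<close> precedes \<epsilon>, because the shapes are selected by
  its cover numbers; the cover of K/H follows \<epsilon>, because it depends on the shapes.\<close>

lemma H_top_subadditive:
  assumes S: "monoid_cancel S" and net: "right_folner_net S I r F"
    and H: "subgroup H G" "closedin T H" "invariant_under S \<rho> H" and \<U>: "open_cover T \<U>"
  shows "\<exists>\<V>. open_cover (subtopology T H) \<V> \<and> (\<forall>\<epsilon>>0. \<exists>\<W>. open_cover (coset_topology G T H) \<W> \<and>
    H_top I r F T \<rho> \<U> \<le> H_top I r F (subtopology T H) (restricted_action \<rho> H) \<V> +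
      H_top I r F (coset_topology G T H) (coset_action G \<rho> H) \<W> + \<epsilon>)"
proof -
  interpret K: coset_space_action G T S \<rho> "carrier G" "{\<one>}" T "\<lambda>x. x" \<rho>
    using H by (rule coset_space_trivial)
  interpret H: coset_space_action G T S \<rho> H "{\<one>}" "subtopology T H" "\<lambda>x. x" "restricted_action \<rho> H"
    using H by (rule coset_space_subgroup)
  interpret Q: coset_space_action G T S \<rho> "carrier G" H "coset_topology G T H" "\<lambda>k. k <# H" "coset_action G \<rho> H"
    using H by (rule coset_space_quotient)
  have dir: "directed_preorder I r" using net unfolding right_folner_net_def by blast
  let ?N = "net_filter I r"
  have inI: "eventually (\<lambda>i. finite (F i) \<and> F i \<noteq> {} \<and> F i \<subseteq> carrier S) ?N"
    by (rule eventually_mono[OF eventually_in_net[OF dir]]) (use net in \<open>auto simp: right_folner_net_def\<close>)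
  obtain \<V> where \<V>: "open_cover (subtopology T H) \<V>"
    and le: "\<forall>\<E>. finite \<E> \<longrightarrow> (\<forall>E\<in>\<E>. E \<noteq> {} \<and> finite E \<and> E \<subseteq> carrier S) \<longrightarrow>
     (\<exists>\<W>. open_cover (coset_topology G T H) \<W> \<and> (\<forall>F Q. finite F \<longrightarrow> F \<noteq> {} \<longrightarrow> F \<subseteq> carrier S \<longrightarrow>
       finite Q \<longrightarrow> Q \<subseteq> F \<times> \<E> \<longrightarrow> F = (\<Union>(c, E)\<in>Q. (\<otimes>\<^bsub>S\<^esub>) c ` E) \<longrightarrow>
       cover_number T (cover_along T \<rho> \<U> F)
       \<le> cover_number (coset_topology G T H) (cover_along (coset_topology G T H) (coset_action G \<rho> H) \<W> F) *
         (\<Prod>(c, E)\<in>Q. cover_number (subtopology T H) (cover_along (subtopology T H) (restricted_action \<rho> H) \<V> E))))"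
    using cover_number_subadditive[OF H \<U>] by (elim exE conjE)
  note limK = H_top_tendsto[OF S net K.right_action_X K.compact_X K.topspace_X_nonempty \<U>]
  note limH = H_top_tendsto[OF S net H.right_action_X H.compact_X H.topspace_X_nonempty \<V>]
  define nH where "nH = (\<lambda>E. cover_number (subtopology T H) (cover_along (subtopology T H) (restricted_action \<rho> H) \<V> E))"
  define nK where "nK = (\<lambda>E. cover_number T (cover_along T \<rho> \<U> E))"
  define l where "l = H_top I r F (subtopology T H) (restricted_action \<rho> H) \<V>"
  have nH_pos: "0 < nH E" if "E \<noteq> {}" "finite E" "E \<subseteq> carrier S" for E unfolding nH_def
    by (rule cover_number_pos[OF H.compact_X \<V> that(2,1) _ H.topspace_X_nonempty])
      (use H.continuous_sigma that(3) in blast)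
  have nK_pos: "0 < nK E" if "E \<noteq> {}" "finite E" "E \<subseteq> carrier S" for E unfolding nK_def
    by (rule cover_number_pos[OF K.compact_X \<U> that(2,1) _ K.topspace_X_nonempty])
      (use K.continuous_sigma that(3) in blast)
  have l0: "0 \<le> l" and liml: "((\<lambda>i. ln (real (nH (F i))) / real (card (F i))) \<longlongrightarrow> l) ?N"
    using limH unfolding l_def nH_def by auto
  have "\<exists>\<W>. open_cover (coset_topology G T H) \<W> \<and>
    H_top I r F T \<rho> \<U> \<le> l + H_top I r F (coset_topology G T H) (coset_action G \<rho> H) \<W> + \<epsilon>"
    if \<epsilon>: "\<epsilon> > 0" for \<epsilon>
  proof -
    have "eventually (\<lambda>i. ln (real (nH (F i))) / real (card (F i)) < l + \<epsilon> / 2) ?N"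
      by (rule order_tendstoD(2)[OF liml]) (use \<epsilon> in simp)
    with inI have "eventually (\<lambda>i. ln (real (nH (F i))) \<le> (l + \<epsilon> / 2) * real (card (F i))) ?N"
    proof eventually_elim
      case (elim i)
      then have "0 < card (F i)" by (simp add: card_gt_0_iff)
      then show ?case using elim(2) by (simp add: pos_divide_less_eq)
    qed
    then have freq: "frequently (\<lambda>i. ln (real (nH (F i))) \<le> (l + \<epsilon> / 2) * real (card (F i))) ?N"
      by (rule eventually_frequently[OF net_filter_neq_bot[OF dir]])
    have nonneg: "\<forall>E. E \<noteq> {} \<longrightarrow> finite E \<longrightarrow> E \<subseteq> carrier S \<longrightarrow> 0 \<le> ln (real (nH E))"
      using nH_pos by (simp add: Suc_le_eq)
    \<comment> \<open>Half of \<epsilon> allows shapes whose logarithmic cover number per element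
      slightly exceeds the limit \<open>l\<close>; the other half pays for overlaps and leftover
      points of the tiling.\<close>
    have "0 \<le> l + \<epsilon> / 2" "\<epsilon> / 2 > 0" using l0 \<epsilon> by auto
    from monoid_cancel.folner_tiling[where f = "\<lambda>E. ln (real (nH E))", OF S net nonneg freq this]
    obtain \<E> where \<E>: "finite \<E>" "\<forall>E\<in>\<E>. E \<noteq> {} \<and> finite E \<and> E \<subseteq> carrier S"
      and tile: "eventually (\<lambda>i. \<exists>Q\<subseteq>F i \<times> \<E>. finite Q \<and> F i = (\<Union>(c, E)\<in>Q. (\<otimes>\<^bsub>S\<^esub>) c ` E) \<and>
        (\<Sum>(c, E)\<in>Q. ln (real (nH E))) \<le> (l + \<epsilon> / 2 + \<epsilon> / 2) * real (card (F i))) ?N"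
      by (elim exE conjE)
    obtain \<W> where \<W>: "open_cover (coset_topology G T H) \<W>"
      and le': "\<forall>F Q. finite F \<longrightarrow> F \<noteq> {} \<longrightarrow> F \<subseteq> carrier S \<longrightarrow>
       finite Q \<longrightarrow> Q \<subseteq> F \<times> \<E> \<longrightarrow> F = (\<Union>(c, E)\<in>Q. (\<otimes>\<^bsub>S\<^esub>) c ` E) \<longrightarrow>
       nK F \<le> cover_number (coset_topology G T H) (cover_along (coset_topology G T H) (coset_action G \<rho> H) \<W> F) *
         (\<Prod>(c, E)\<in>Q. nH E)"
      using mp[OF mp[OF spec[OF le] \<E>(1)] \<E>(2)] unfolding nK_def nH_def by (elim exE conjE)
    define nQ where "nQ = (\<lambda>E. cover_number (coset_topology G T H) (cover_along (coset_topology G T H) (coset_action G \<rho> H) \<W> E))"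
    note limQ = H_top_tendsto[OF S net Q.right_action_X Q.compact_X Q.topspace_X_nonempty \<W>]
    have "eventually (\<lambda>i. ln (real (nK (F i))) / real (card (F i)) \<le>
      ln (real (nQ (F i))) / real (card (F i)) + (l + \<epsilon>)) ?N"
      using tile inI
    proof eventually_elim
      case (elim i)
      from elim(1) obtain Q where Q: "Q \<subseteq> F i \<times> \<E>" "finite Q" "F i = (\<Union>(c, E)\<in>Q. (\<otimes>\<^bsub>S\<^esub>) c ` E)"
        and sum0: "(\<Sum>(c, E)\<in>Q. ln (real (nH E))) \<le> (l + \<epsilon> / 2 + \<epsilon> / 2) * real (card (F i))"
        by (elim exE conjE)
      have "l + \<epsilon> / 2 + \<epsilon> / 2 = l + \<epsilon>" by simp
      with sum0 have sum: "(\<Sum>q\<in>Q. ln (real (nH (snd q)))) \<le> (l + \<epsilon>) * real (card (F i))"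
        unfolding case_prod_unfold by (simp only:)
      have Fi: "F i \<noteq> {}" "finite (F i)" "F i \<subseteq> carrier S" using elim(2) by auto
      have posQ: "0 < nH (snd q)" if "q \<in> Q" for q
      proof -
        have "snd q \<in> \<E>" using subsetD[OF Q(1) that] by (simp add: mem_Times_iff)
        then show ?thesis using nH_pos[of "snd q"] \<E>(2) by simp
      qed
      have "0 < nQ (F i)" unfolding nQ_def
        by (rule cover_number_pos[OF Q.compact_X \<W> Fi(2,1) _ Q.topspace_X_nonempty])
          (use Q.continuous_sigma Fi(3) in blast)
      moreover have "0 < (\<Prod>q\<in>Q. real (nH (snd q)))" using posQ by (intro prod_pos) auto
      moreover have "nK (F i) \<le> nQ (F i) * (\<Prod>q\<in>Q. nH (snd q))"
        using le'[rule_format, OF Fi(2,1,3) Q(2,1,3)] unfolding nQ_def case_prod_unfold .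
      then have "real (nK (F i)) \<le> real (nQ (F i)) * (\<Prod>q\<in>Q. real (nH (snd q)))"
        by (simp flip: of_nat_mult of_nat_prod)
      ultimately have "ln (real (nK (F i))) \<le> ln (real (nQ (F i))) + ln (\<Prod>q\<in>Q. real (nH (snd q)))"
        using nK_pos[OF Fi] by (subst ln_mult_pos[symmetric]) (auto intro!: ln_mono)
      also have "ln (\<Prod>q\<in>Q. real (nH (snd q))) = (\<Sum>q\<in>Q. ln (real (nH (snd q))))"
        by (rule ln_prod[OF Q(2)]) (use posQ in fastforce)
      finally have "ln (real (nK (F i))) \<le> ln (real (nQ (F i))) + (l + \<epsilon>) * real (card (F i))"
        using sum by linarith
      then have "ln (real (nK (F i))) / real (card (F i)) \<le>
          (ln (real (nQ (F i))) + (l + \<epsilon>) * real (card (F i))) / real (card (F i))"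
        by (rule divide_right_mono) simp
      then show ?case using Fi by (simp add: add_divide_distrib)
    qed
    then have "H_top I r F T \<rho> \<U> \<le> H_top I r F (coset_topology G T H) (coset_action G \<rho> H) \<W> + (l + \<epsilon>)"
      unfolding nK_def nQ_def
      by (rule tendsto_le[OF net_filter_neq_bot[OF dir] tendsto_add[OF limQ(1) tendsto_const] limK(1)])
    then show ?thesis using \<W> by (intro exI[of _ \<W>]) simp
  qed
  then show ?thesis using \<V> unfolding l_def by blast
qed

end

text \<open>Nonnegative terms over nonempty index sets keep the sums away from \<infinity> -
  \<infinity>, so the suprema can be pulled out one after the other.\<close>

lemma SUP_add_SUP_le_ereal:
  fixes f g :: "_ \<Rightarrow> ereal"
  assumes "A \<noteq> {}" "B \<noteq> {}" and nonneg: "\<And>y. y \<in> B \<Longrightarrow> 0 \<le> g y" "\<And>x. x \<in> A \<Longrightarrow> 0 \<le> f x"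
    and le: "\<And>x y. x \<in> A \<Longrightarrow> y \<in> B \<Longrightarrow> f x + g y \<le> c"
  shows "(SUP x\<in>A. f x) + (SUP y\<in>B. g y) \<le> c"
proof -
  obtain b where "b \<in> B" using assms(2) by blast
  then have "0 \<le> (SUP y\<in>B. g y)" using nonneg(1) by (meson SUP_upper2)
  then have "(SUP x\<in>A. f x) + (SUP y\<in>B. g y) = (SUP x\<in>A. f x + (SUP y\<in>B. g y))"
    using assms(1) by (intro SUP_ereal_add_left[symmetric]) auto
  also have "\<dots> \<le> c"
  proof (rule SUP_least)
    fix x assume x: "x \<in> A"
    have "f x + (SUP y\<in>B. g y) = (SUP y\<in>B. f x + g y)"
      using assms(2) nonneg(2)[OF x] by (intro SUP_ereal_add_right[symmetric]) auto
    also have "\<dots> \<le> c" using le x by (intro SUP_least)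
    finally show "f x + (SUP y\<in>B. g y) \<le> c" .
  qed
  finally show ?thesis .
qed

lemma open_cover_topspace: "open_cover X {topspace X}"
  by (simp add: open_cover_def)

theorem mainTheorem1:
  fixes S :: "('s, 'm) monoid_scheme"
    and K :: "('k, 'n) monoid_scheme" and T :: "'k topology"
    and \<rho> :: "'s \<Rightarrow> 'k \<Rightarrow> 'k" and H :: "'k set"
    and I :: "'i set" and r :: "'i rel" and F :: "'i \<Rightarrow> 's set"
  assumes "monoid_cancel S" and "right_amenable S"
    and "compact_group K T"
    and "right_group_action S K T \<rho>"
    and "subgroup H K" and "closedin T H" and "invariant_under S \<rho> H"
    and "right_folner_net S I r F"
  shows "h_top I r F T \<rho> =
    h_top I r F (subtopology T H) (restricted_action \<rho> H) +
    h_top I r F (coset_topology K T H) (coset_action K \<rho> H)"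
proof -
  note S = assms(1) and net = assms(8) and H = assms(5,6,7)
  interpret compact_group_action K T S \<rho>
    by (intro compact_group_action.intro compact_group_action_axioms.intro assms(3,4)
        monoid_cancel.axioms(1)[OF S])
  interpret H: coset_space_action K T S \<rho> H "{\<one>\<^bsub>K\<^esub>}" "subtopology T H" "\<lambda>x. x" "restricted_action \<rho> H"
    using H by (rule coset_space_subgroup)
  interpret Q: coset_space_action K T S \<rho> "carrier K" H "coset_topology K T H" "\<lambda>k. k <#\<^bsub>K\<^esub> H" "coset_action K \<rho> H"
    using H by (rule coset_space_quotient)
  let ?hK = "H_top I r F T \<rho>" and ?hH = "H_top I r F (subtopology T H) (restricted_action \<rho> H)"
    and ?hQ = "H_top I r F (coset_topology K T H) (coset_action K \<rho> H)"
  show ?thesis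
  proof (rule antisym)
    show "h_top I r F T \<rho> \<le> h_top I r F (subtopology T H) (restricted_action \<rho> H) +
        h_top I r F (coset_topology K T H) (coset_action K \<rho> H)" (is "_ \<le> ?a + ?b")
      unfolding h_top_def[of _ _ _ T]
    proof (rule SUP_least)
      fix \<U> assume "\<U> \<in> {\<U>. open_cover T \<U>}"
      then have \<U>: "open_cover T \<U>" by simp
      obtain \<V> where \<V>: "open_cover (subtopology T H) \<V>"
        and le: "\<forall>\<epsilon>>0. \<exists>\<W>. open_cover (coset_topology K T H) \<W> \<and> ?hK \<U> \<le> ?hH \<V> + ?hQ \<W> + \<epsilon>"
        using H_top_subadditive[OF S net H \<U>] by (elim exE conjE)
      \<comment> \<open>The cover of K/H varies with \<epsilon>, so its entropy is bounded by the
        supremum before \<epsilon> tends to 0.\<close>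
      have "ereal (?hK \<U>) \<le> ?a + ?b + ereal \<epsilon>" if \<epsilon>: "0 < \<epsilon>" for \<epsilon>
      proof -
        obtain \<W> where \<W>: "open_cover (coset_topology K T H) \<W>" "?hK \<U> \<le> ?hH \<V> + ?hQ \<W> + \<epsilon>"
          using le \<epsilon> by blast
        have "ereal (?hK \<U>) \<le> ereal (?hH \<V>) + ereal (?hQ \<W>) + ereal \<epsilon>" using \<W>(2) by simp
        also have "\<dots> \<le> ?a + ?b + ereal \<epsilon>"
          unfolding h_top_def using \<V> \<W>(1) by (intro add_mono SUP_upper order_refl) auto
        finally show ?thesis .
      qed
      then show "ereal (?hK \<U>) \<le> ?a + ?b" by (rule ereal_le_epsilon2)
    qed
    show "h_top I r F (subtopology T H) (restricted_action \<rho> H) +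
        h_top I r F (coset_topology K T H) (coset_action K \<rho> H) \<le> h_top I r F T \<rho>"
      unfolding h_top_def[of _ _ _ "subtopology T H"] h_top_def[of _ _ _ "coset_topology K T H"]
    proof (rule SUP_add_SUP_le_ereal)
      fix \<V> \<W> assume "\<V> \<in> {\<V>. open_cover (subtopology T H) \<V>}" "\<W> \<in> {\<W>. open_cover (coset_topology K T H) \<W>}"
      then have "open_cover (subtopology T H) \<V>" "open_cover (coset_topology K T H) \<W>" by simp_all
      from H_top_superadditive[OF S net H this]
      obtain \<U> where \<U>: "open_cover T \<U>" "?hH \<V> + ?hQ \<W> \<le> ?hK \<U>" by (elim exE conjE)
      have "ereal (?hH \<V>) + ereal (?hQ \<W>) \<le> ereal (?hK \<U>)" using \<U>(2) by simp
      also have "\<dots> \<le> h_top I r F T \<rho>" unfolding h_top_def using \<U>(1) by (intro SUP_upper) simp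
      finally show "ereal (?hH \<V>) + ereal (?hQ \<W>) \<le> h_top I r F T \<rho>" .
    qed (use open_cover_topspace
        H_top_tendsto(2)[OF S net H.right_action_X H.compact_X H.topspace_X_nonempty]
        H_top_tendsto(2)[OF S net Q.right_action_X Q.compact_X Q.topspace_X_nonempty] in auto)
  qed
qed

end
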